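(* Let $(G,C)$ be a strongly connected inhomogeneous Mauldin-Williams graph in $\mathbb{R}^d$ with vertex set $V$, satisfying the strong condensation open set condition (SCOSC), and let $s_0(G)$ and $(K_i^C)_{i\in V}$ be as defined in the context. Suppose that there exists $i_0\in V$ such that $$\int_0^\infty e^{-s_0(G)t}N_{e^{-t}}(C_{i_0})\,\mathrm{d}t=\infty.$$ Then $$\lim_{t\to\infty}\frac{N_{e^{-t}}(K_i^C)}{e^{s_0(G)t}}=\infty$$ for all $i\in V$.
   Context: **Covering number.** For a bounded set $A\subset\mathbb{R}^d$ and $r>0$, $N_r(A)$ is the least number of closed balls of radius $r$ (with arbitrary centres in $\mathbb{R}^d$) needed to cover $A$; $N_r(\emptyset)=0$. **Mauldin-Williams graph.** $G=((V,E),(X_i)_{i\in V},(S_e)_{e\in E})$, where $(V,E)$ is a finite directed multigraph (each edge $e\in E$ has an initial vertex $i(e)$ and a terminal vertex $t(e)$; parallel edges and loops are allowed), each $X_i\subset\mathbb{R}^d$ is a non-empty compact set equal to the closure of its interior, and each $S_e\colon X_{t(e)}\to X_{i(e)}$ is a contractive similarity with contraction ratio $0<r_e<1$, i.e. $|S_e(x)-S_e(y)|=r_e|x-y|$. Write $E_i=\{e\in E: i(e)=i\}$ and $E_{ij}=\{e\in E_i: t(e)=j\}$. A path of length $n\ge1$ is a list $(e_1,\dots,e_n)$ of edges with $t(e_k)=i(e_{k+1})$ for $1\le k<n$; it goes from $i(e_1)$ to $t(e_n)$. $G$ is strongly connected if for each pair $i,j\in V$ (including $i=j$) there is a path of length at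 least $1$ from $i$ to $j$. **Inhomogeneous Mauldin-Williams graph.** A pair $(G,C)$, where $G$ is a Mauldin-Williams graph and $C=(C_i)_{i\in V}$ is a list of (possibly empty) compact sets with $C_i\subset X_i$. $(G,C)$ is strongly connected if $G$ is. There are unique lists of non-empty compact sets $K_i\subset X_i$ and $K_i^C\subset X_i$ ($i\in V$) with $$K_i=\bigcup_{e\in E_i}S_e(K_{t(e)}),\qquad K_i^C=C_i\cup\bigcup_{e\in E_i}S_e(K_{t(e)}^C).$$ **SCOSC.** $(G,C)$ satisfies the strong condensation open set condition if there are non-empty bounded open sets $U_i\subset X_i$ ($i\in V$) such that for all $i\in V$: $\bigcup_{e\in E_i}S_e(U_{t(e)})\subset U_i$; $S_e(U_{t(e)})\cap S_{e'}(U_{t(e')})=\emptyset$ for all distinct $e,e'\in E_i$; $U_i\cap K_i\ne\emptyset$; and $C_i\subset\overline{U_i}\setminus\bigcup_{e\in E_i}S_e(U_{t(e)})$. **The exponent $s_0(G)$.** For $s\ge 0$ let $A_G^s=\bigl(\sum_{e\in E_{ij}}r_e^s\bigr)_{i,j\in V}$. $s_0(G)\ge 0$ is the unique solution $s$ of $\rho(A_G^s)=1$, where $\rho$ denotes the spectral radius. *)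

theory Defs
  imports
    "Graph_Theory.Arc_Walk"
    "Jordan_Normal_Form.Spectral_Radius"
    "HOL-Analysis.Analysis"
begin

text \<open>The number of closed balls is counted by the number of centres; for \<open>r > 0\<close> distinct
  centres give distinct balls.\<close>

definition covering_number :: "real \<Rightarrow> 'a::euclidean_space set \<Rightarrow> nat" where
  "covering_number r A = (LEAST n. \<exists>F. finite F \<and> card F = n \<and> A \<subseteq> (\<Union>x\<in>F. cball x r))"

text \<open>The initial vertex \<open>i(e)\<close> of an edge is \<open>tail G e\<close>, its terminal vertex \<open>t(e)\<close> is
  \<open>head G e\<close>, and \<open>E\<^sub>i\<close> is \<open>out_arcs G i\<close>. The map \<open>S e\<close> is only relevant on \<open>X (head G e)\<close>;
  its values elsewhere are arbitrary.\<close>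

locale mauldin_williams_graph = fin_digraph G
  for G :: "('v, 'e) pre_digraph" (structure) +
  fixes X :: "'v \<Rightarrow> 'a::euclidean_space set"
    and S :: "'e \<Rightarrow> 'a \<Rightarrow> 'a"
    and r :: "'e \<Rightarrow> real"
  assumes space_nonempty: "i \<in> verts G \<Longrightarrow> X i \<noteq> {}"
    and space_compact: "i \<in> verts G \<Longrightarrow> compact (X i)"
    and space_regular: "i \<in> verts G \<Longrightarrow> X i = closure (interior (X i))"
    and map_into: "e \<in> arcs G \<Longrightarrow> S e ` X (head G e) \<subseteq> X (tail G e)"
    and ratio_pos: "e \<in> arcs G \<Longrightarrow> 0 < r e"
    and ratio_less_one: "e \<in> arcs G \<Longrightarrow> r e < 1"
    and map_similarity: "e \<in> arcs G \<Longrightarrow> x \<in> X (head G e) \<Longrightarrow> y \<in> X (head G e) \<Longrightarrow>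
      dist (S e x) (S e y) = r e * dist x y"

locale inhom_mauldin_williams_graph = mauldin_williams_graph G X S r
  for G :: "('v, 'e) pre_digraph" (structure)
    and X :: "'v \<Rightarrow> 'a::euclidean_space set"
    and S :: "'e \<Rightarrow> 'a \<Rightarrow> 'a"
    and r :: "'e \<Rightarrow> real" +
  fixes C :: "'v \<Rightarrow> 'a set"
  assumes condensation_compact: "i \<in> verts G \<Longrightarrow> compact (C i)"
    and condensation_subset: "i \<in> verts G \<Longrightarrow> C i \<subseteq> X i"

text \<open>Unlike \<open>strongly_connected\<close> of the Graph_Theory library, walks of length zero do not
  count, even from a vertex to itself.\<close>

definition mw_strongly_connected :: "('v, 'e) pre_digraph \<Rightarrow> bool" where
  "mw_strongly_connected G \<longleftrightarrow>
     (\<forall>i\<in>verts G. \<forall>j\<in>verts G. \<exists>p. length p \<ge> 1 \<and> pre_digraph.awalk G i p j)"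

text \<open>The list \<open>(K\<^sup>C\<^sub>i)\<close>, as a function made unique by being \<open>undefined\<close> off the vertex set.\<close>

definition inhom_attractor ::
  "('v, 'e) pre_digraph \<Rightarrow> ('v \<Rightarrow> 'a::euclidean_space set) \<Rightarrow> ('e \<Rightarrow> 'a \<Rightarrow> 'a) \<Rightarrow>
    ('v \<Rightarrow> 'a set) \<Rightarrow> 'v \<Rightarrow> 'a set" where
  "inhom_attractor G X S C = (THE K. K \<in> extensional (verts G) \<and>
     (\<forall>i\<in>verts G. K i \<noteq> {} \<and> compact (K i) \<and> K i \<subseteq> X i \<and>
        K i = C i \<union> (\<Union>e\<in>out_arcs G i. S e ` K (head G e))))"

definition attractor ::
  "('v, 'e) pre_digraph \<Rightarrow> ('v \<Rightarrow> 'a::euclidean_space set) \<Rightarrow> ('e \<Rightarrow> 'a \<Rightarrow> 'a) \<Rightarrow>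
    'v \<Rightarrow> 'a set" where
  "attractor G X S = (THE K. K \<in> extensional (verts G) \<and>
     (\<forall>i\<in>verts G. K i \<noteq> {} \<and> compact (K i) \<and> K i \<subseteq> X i \<and>
        K i = (\<Union>e\<in>out_arcs G i. S e ` K (head G e))))"

definition strong_condensation_osc ::
  "('v, 'e) pre_digraph \<Rightarrow> ('v \<Rightarrow> 'a::euclidean_space set) \<Rightarrow> ('e \<Rightarrow> 'a \<Rightarrow> 'a) \<Rightarrow>
    ('v \<Rightarrow> 'a set) \<Rightarrow> bool" where
  "strong_condensation_osc G X S C \<longleftrightarrow> (\<exists>U. \<forall>i\<in>verts G.
     U i \<noteq> {} \<and> bounded (U i) \<and> open (U i) \<and> U i \<subseteq> X i \<and>
     (\<Union>e\<in>out_arcs G i. S e ` U (head G e)) \<subseteq> U i \<and>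
     (\<forall>e\<in>out_arcs G i. \<forall>e'\<in>out_arcs G i. e \<noteq> e' \<longrightarrow>
        S e ` U (head G e) \<inter> S e' ` U (head G e') = {}) \<and>
     U i \<inter> attractor G X S i \<noteq> {} \<and>
     C i \<subseteq> closure (U i) - (\<Union>e\<in>out_arcs G i. S e ` U (head G e)))"

text \<open>Library matrices are indexed by \<open>0, \<dots>, n - 1\<close>, so the vertices are numbered in an
  arbitrary way; renumbering conjugates \<open>ratio_matrix\<close> by a permutation matrix and does not
  affect its spectral radius.\<close>

definition vertex_enum :: "('v, 'e) pre_digraph \<Rightarrow> nat \<Rightarrow> 'v" where
  "vertex_enum G = (SOME f. bij_betw f {0..<card (verts G)} (verts G))"

definition ratio_matrix ::
  "('v, 'e) pre_digraph \<Rightarrow> ('e \<Rightarrow> real) \<Rightarrow> real \<Rightarrow> complex Matrix.mat" where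
  "ratio_matrix G r s = Matrix.mat (card (verts G)) (card (verts G)) (\<lambda>(k, l).
     \<Sum>e | e \<in> out_arcs G (vertex_enum G k) \<and> head G e = vertex_enum G l.
       complex_of_real (r e powr s))"

definition s0 :: "('v, 'e) pre_digraph \<Rightarrow> ('e \<Rightarrow> real) \<Rightarrow> real" where
  "s0 G r = (THE s. s \<ge> 0 \<and> spectral_radius (ratio_matrix G r s) = 1)"

end

theory Submission
  imports Defs "HOL-Homology.Invariance_of_Domain" "HOL-Real_Asymp.Real_Asymp" "HOL-Library.Sublist"
begin

text \<open>For a word \<open>w\<close> of edges write \<open>S\<^sub>w\<close> for its composed map and \<open>r\<^sub>w\<close> for its ratio. Since each
  \<open>U\<^sub>i\<close> meets \<open>K\<^sub>i\<close>, every vertex \<open>i\<close> has a path \<open>w(i)\<close> to \<open>i\<^sub>0\<close> whose map sends \<open>X\<^sub>i\<^sub>0\<close> into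
  \<open>U\<^sub>i\<close>, at distance at least some \<open>\<eta> > 0\<close> from the complement. Consider the pieces
  \<open>P\<^sub>p = S\<^sub>p S\<^sub>w C\<close> of \<open>K\<^sub>i\<^sup>C\<close>, where \<open>C = C\<^sub>i\<^sub>0\<close>, \<open>p\<close> is a path from \<open>i\<close> and \<open>w\<close> is the path
  attached to its end. If \<open>q\<close> is not a prefix of \<open>pw\<close>, then \<open>P\<^sub>p\<close> avoids the open set
  \<open>S\<^sub>q U\<close>, in which \<open>P\<^sub>q\<close> lies at depth \<open>\<eta> r\<^sub>q\<close>. Hence the pieces with \<open>\<eta> r\<^sub>p > 2\<delta>\<close> that
  meet a given \<open>\<delta>\<close>-ball form a chain of prefixes whose lengths differ by at most \<open>max |w|\<close>, and
  \<open>N\<^sub>\<delta>(K\<^sub>i\<^sup>C)\<close> is, up to a constant, at least the sum of the \<open>N\<^sub>\<delta>(P\<^sub>p)\<close>.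

  With \<open>\<phi>(t)\<close> the covering number of \<open>C\<close> at radius \<open>e\<^sup>-\<^sup>t\<close>, this sum is, up to constants and a
  shift of \<open>T\<close>, at least \<open>H\<^sub>i(T) = \<Sum>\<^sub>p \<phi>(T + ln r\<^sub>p)\<close>, which satisfies
  \<open>H\<^sub>i(T) = \<phi>(T) + \<Sum>\<^sub>e H\<^sub>t\<^sub>(\<^sub>e\<^sub>)(T + ln r\<^sub>e)\<close>. As the spectral radius is 1 at \<open>s = s\<^sub>0(G)\<close>, there is a
  positive \<open>v\<close> with \<open>v \<le> A\<^sup>s v\<close>, and induction along this equation bounds \<open>e\<^sup>-\<^sup>s\<^sup>T H\<^sub>i(T)\<close> from below
  by a multiple of \<open>\<integral> e\<^sup>-\<^sup>s\<^sup>t \<phi>(t) dt\<close> over \<open>[0, T]\<close>, which is unbounded by hypothesis.\<close>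

section \<open>Spectral radius of a nonnegative matrix\<close>

text \<open>The entries are real, but the matrix is complex because eigenvalues and
  \<open>spectral_radius\<close> are taken over the complex numbers.\<close>

definition real_mat :: "nat \<Rightarrow> (nat \<Rightarrow> nat \<Rightarrow> real) \<Rightarrow> complex Matrix.mat" where
  "real_mat n a = Matrix.mat n n (\<lambda>(i, j). complex_of_real (a i j))"

lemma real_mat_carrier: "real_mat n a \<in> carrier_mat n n"
  by (simp add: real_mat_def)

lemma real_mat_mult_vec:
  assumes "v \<in> carrier_vec n"
  shows "real_mat n a *\<^sub>v v = Matrix.vec n (\<lambda>i. \<Sum>j<n. complex_of_real (a i j) * vec_index v j)"
  using assms
  by (intro eq_vecI) (auto simp: real_mat_def scalar_prod_def lessThan_atLeast0)

lemma real_mat_eigenvalueE: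
  assumes "eigenvalue (real_mat n a) \<mu>"
  obtains v where "\<And>i. i < n \<Longrightarrow> (\<Sum>j<n. complex_of_real (a i j) * v j) = \<mu> * v i"
    and "\<exists>i<n. v i \<noteq> 0"
proof -
  obtain w where w: "w \<in> carrier_vec n" "w \<noteq> 0\<^sub>v n" "real_mat n a *\<^sub>v w = \<mu> \<cdot>\<^sub>v w"
    using assms by (auto simp: eigenvalue_def eigenvector_def real_mat_def)
  have "(\<Sum>j<n. complex_of_real (a i j) * vec_index w j) = \<mu> * vec_index w i" if "i < n" for i
    using arg_cong[OF w(3), of "\<lambda>x. vec_index x i"] that w(1) by (simp add: real_mat_mult_vec)
  moreover have "\<exists>i<n. vec_index w i \<noteq> 0"
  proof (rule ccontr)
    assume "\<not> ?thesis"
    then have "w = 0\<^sub>v n" using w(1) by (intro eq_vecI) auto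
    then show False using w(2) by simp
  qed
  ultimately show ?thesis using that[of "vec_index w"] by blast
qed

lemma real_mat_eigenvalueI:
  assumes "\<And>i. i < n \<Longrightarrow> (\<Sum>j<n. complex_of_real (a i j) * v j) = \<mu> * v i"
    and "\<exists>i<n. v i \<noteq> 0"
  shows "eigenvalue (real_mat n a) \<mu>"
proof -
  have "real_mat n a *\<^sub>v Matrix.vec n v = \<mu> \<cdot>\<^sub>v Matrix.vec n v"
    using assms(1) by (subst real_mat_mult_vec) (auto intro!: eq_vecI)
  moreover have "Matrix.vec n v \<noteq> 0\<^sub>v n"
  proof
    assume z: "Matrix.vec n v = 0\<^sub>v n"
    obtain i where "i < n" "v i \<noteq> 0" using assms(2) by blast
    with arg_cong[OF z, of "\<lambda>x. vec_index x i"] show False by simp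
  qed
  ultimately have "eigenvector (real_mat n a) (Matrix.vec n v) \<mu>"
    using real_mat_carrier[of n a] by (auto simp: eigenvector_def)
  then show ?thesis by (auto simp: eigenvalue_def)
qed

text \<open>Take an eigenvector for an eigenvalue of maximal modulus and replace its entries by
  their absolute values; the triangle inequality gives the claim. Subinvariance is all that later
  arguments need, so no Perron eigenvector is constructed.\<close>

lemma spectral_radius_subinvariant:
  assumes "0 < n" and nn: "\<And>i j. i < n \<Longrightarrow> j < n \<Longrightarrow> 0 \<le> a i j"
  obtains u :: "nat \<Rightarrow> real" where "\<And>i. 0 \<le> u i" and "\<exists>i<n. 0 < u i"
    and "\<And>i. i < n \<Longrightarrow> spectral_radius (real_mat n a) * u i \<le> (\<Sum>j<n. a i j * u j)"
proof -
  obtain \<mu> where \<mu>: "eigenvalue (real_mat n a) \<mu>" "spectral_radius (real_mat n a) = norm \<mu>"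
    using spectral_radius_mem_max(1)[OF real_mat_carrier \<open>0 < n\<close>, of a]
    by (auto simp: spectrum_def)
  obtain v where v: "\<And>i. i < n \<Longrightarrow> (\<Sum>j<n. complex_of_real (a i j) * v j) = \<mu> * v i"
    and nz: "\<exists>i<n. v i \<noteq> 0"
    using real_mat_eigenvalueE[OF \<mu>(1)] by blast
  show ?thesis
  proof
    show "\<exists>i<n. 0 < norm (v i)" using nz by simp
    fix i assume i: "i < n"
    have "norm \<mu> * norm (v i) = norm (\<Sum>j<n. complex_of_real (a i j) * v j)"
      using v[OF i] by (simp add: norm_mult)
    also have "\<dots> \<le> (\<Sum>j<n. norm (complex_of_real (a i j) * v j))" by (rule norm_sum)
    also have "\<dots> = (\<Sum>j<n. a i j * norm (v j))"
      using nn[OF i] by (intro sum.cong) (auto simp: norm_mult)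
    finally show "spectral_radius (real_mat n a) * norm (v i) \<le> (\<Sum>j<n. a i j * norm (v j))"
      using \<mu>(2) by simp
  qed auto
qed

text \<open>Nonnegativity lets the inequality be multiplied by the matrix again, so each application
  gains a factor \<open>q\<close>. The vector \<open>x\<close> records that the iterates stay real
  inside the complex vector space.\<close>

lemma real_mat_power_mult_vec_ge:
  assumes nn: "\<And>i j. i < n \<Longrightarrow> j < n \<Longrightarrow> 0 \<le> a i j" and "0 \<le> q"
    and sub: "\<And>i. i < n \<Longrightarrow> q * u i \<le> (\<Sum>j<n. a i j * u j)"
  shows "\<exists>x. real_mat n a ^\<^sub>m k *\<^sub>v Matrix.vec n (\<lambda>i. complex_of_real (u i))
            = Matrix.vec n (\<lambda>i. complex_of_real (x i)) \<and> (\<forall>i<n. q ^ k * u i \<le> x i)"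
  using sub
proof (induction k arbitrary: u)
  case 0
  have "dim_row (real_mat n a) = n" by (simp add: real_mat_def)
  then show ?case by (intro exI[of _ u]) auto
next
  case (Suc k)
  define w where "w = (\<lambda>i. \<Sum>j<n. a i j * u j)"
  have step: "real_mat n a *\<^sub>v Matrix.vec n (\<lambda>i. complex_of_real (u i))
      = Matrix.vec n (\<lambda>i. complex_of_real (w i))"
    by (subst real_mat_mult_vec) (auto simp: w_def intro!: eq_vecI)
  have "q * w i \<le> (\<Sum>j<n. a i j * w j)" if "i < n" for i
  proof -
    have "q * w i = (\<Sum>j<n. a i j * (q * u j))"
      by (simp add: w_def sum_distrib_left algebra_simps)
    also have "\<dots> \<le> (\<Sum>j<n. a i j * w j)"
      using Suc.prems nn that by (intro sum_mono mult_left_mono) (auto simp: w_def)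
    finally show ?thesis .
  qed
  from Suc.IH[OF this] obtain x where
    x: "real_mat n a ^\<^sub>m k *\<^sub>v Matrix.vec n (\<lambda>i. complex_of_real (w i))
        = Matrix.vec n (\<lambda>i. complex_of_real (x i))"
       "\<And>i. i < n \<Longrightarrow> q ^ k * w i \<le> x i" by blast
  have "real_mat n a ^\<^sub>m Suc k *\<^sub>v Matrix.vec n (\<lambda>i. complex_of_real (u i))
      = Matrix.vec n (\<lambda>i. complex_of_real (x i))"
    unfolding pow_mat.simps
    by (subst assoc_mult_mat_vec[OF pow_carrier_mat[OF real_mat_carrier] real_mat_carrier])
      (auto simp: step x(1))
  moreover have "q ^ Suc k * u i \<le> x i" if "i < n" for i
  proof -
    have "q ^ Suc k * u i = q ^ k * (q * u i)" by simp
    also have "\<dots> \<le> q ^ k * w i"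
      using Suc.prems[OF that] \<open>0 \<le> q\<close> by (intro mult_left_mono) (auto simp: w_def)
    finally show ?thesis using x(2)[OF that] by simp
  qed
  ultimately show ?case by blast
qed

text \<open>The Collatz-Wielandt lower bound. If \<open>l\<close> exceeded the spectral radius,
  dividing by some \<open>l'\<close> strictly between the two would give a matrix with bounded
  powers, whereas \<open>u\<close> would grow under these powers at least like
  \<open>(l / l') ^ k\<close>.\<close>

lemma spectral_radius_ge:
  assumes nn: "\<And>i j. i < n \<Longrightarrow> j < n \<Longrightarrow> 0 \<le> a i j"
    and u: "\<And>i. i < n \<Longrightarrow> 0 \<le> u i" "\<exists>i<n. 0 < u i"
    and sub: "\<And>i. i < n \<Longrightarrow> l * u i \<le> (\<Sum>j<n. a i j * u j)"
  shows "l \<le> spectral_radius (real_mat n a)"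
proof (rule ccontr)
  let ?\<rho> = "spectral_radius (real_mat n a)"
  assume "\<not> l \<le> ?\<rho>"
  then have less: "?\<rho> < l" by simp
  obtain i0 where i0: "i0 < n" "0 < u i0" using u(2) by blast
  then have "0 < n" by simp
  have \<rho>0: "0 \<le> ?\<rho>"
    using spectral_radius_mem_max(1)[OF real_mat_carrier \<open>0 < n\<close>, of a] by auto
  define l' where "l' = (?\<rho> + l) / 2"
  have l': "0 < l'" "?\<rho> < l'" "l' < l" using less \<rho>0 by (auto simp: l'_def)
  define b where "b = (\<lambda>i j. a i j / l')"
  have eig: "norm \<mu> < 1" if "eigenvalue (real_mat n b) \<mu>" for \<mu>
  proof -
    obtain v where v: "\<And>i. i < n \<Longrightarrow> (\<Sum>j<n. complex_of_real (b i j) * v j) = \<mu> * v i"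
      and nz: "\<exists>i<n. v i \<noteq> 0"
      using real_mat_eigenvalueE[OF \<open>eigenvalue (real_mat n b) \<mu>\<close>] by blast
    have "(\<Sum>j<n. complex_of_real (a i j) * v j) = (l' * \<mu>) * v i" if "i < n" for i
    proof -
      have "(\<Sum>j<n. complex_of_real (a i j) * v j)
          = (\<Sum>j<n. l' * (complex_of_real (b i j) * v j))"
        using l'(1) by (intro sum.cong) (auto simp: b_def)
      also have "\<dots> = l' * (\<mu> * v i)" using v[OF that] by (simp only: sum_distrib_left[symmetric])
      finally show ?thesis by simp
    qed
    then have "eigenvalue (real_mat n a) (l' * \<mu>)"
      using nz by (intro real_mat_eigenvalueI) auto
    then have "norm (l' * \<mu>) \<le> ?\<rho>"
      using spectral_radius_mem_max(2)[OF real_mat_carrier \<open>0 < n\<close>, of "norm (l' * \<mu>)" a]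
      by (auto simp: spectrum_def)
    then have "l' * norm \<mu> \<le> ?\<rho>" using l' by (simp add: norm_mult)
    then have "l' * norm \<mu> < l' * 1" using l' by linarith
    then show ?thesis using l'(1) by (simp only: mult_less_cancel_left_pos)
  qed
  have "spectral_radius (real_mat n b) < 1"
    using spectral_radius_mem_max(1)[OF real_mat_carrier \<open>0 < n\<close>, of b] eig
    by (auto simp: spectrum_def)
  \<comment> \<open>The Jordan normal form bounds the entries of all powers at once when the
    spectral radius is below 1.\<close>
  then obtain c where c: "\<And>k. norm_bound (real_mat n b ^\<^sub>m k) c"
    using spectral_radius_jnf_norm_bound_less_1_upper_triangular[OF real_mat_carrier] by blast
  define q where "q = l / l'"
  have q: "1 < q" using l' by (simp add: q_def)
  have subq: "q * u i \<le> (\<Sum>j<n. b i j * u j)" if "i < n" for i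
    using sub[OF that] l'(1)
    by (simp add: q_def b_def sum_divide_distrib[symmetric] divide_right_mono)
  have bnd: "q ^ k * u i0 \<le> c * (\<Sum>j<n. u j)" for k
  proof -
    let ?B = "real_mat n b ^\<^sub>m k"
    have B: "?B \<in> carrier_mat n n" by (intro pow_carrier_mat real_mat_carrier)
    obtain x where x: "?B *\<^sub>v Matrix.vec n (\<lambda>i. complex_of_real (u i))
            = Matrix.vec n (\<lambda>i. complex_of_real (x i))" "\<forall>i<n. q ^ k * u i \<le> x i"
      using real_mat_power_mult_vec_ge[of n b q u k] nn l' q subq by (force simp: b_def)
    have "complex_of_real (x i0) = (\<Sum>j<n. ?B $$ (i0, j) * complex_of_real (u j))"
      using arg_cong[OF x(1), of "\<lambda>v. vec_index v i0"] carrier_matD[OF B] i0(1)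
      by (simp add: scalar_prod_def lessThan_atLeast0)
    then have "\<bar>x i0\<bar> = norm (\<Sum>j<n. ?B $$ (i0, j) * complex_of_real (u j))"
      by (metis norm_of_real)
    also have "\<dots> \<le> (\<Sum>j<n. norm (?B $$ (i0, j)) * u j)"
      using u(1) by (intro order.trans[OF norm_sum] sum_mono) (auto simp: norm_mult)
    also have "\<dots> \<le> (\<Sum>j<n. c * u j)"
      using c[of k, unfolded norm_bound_def carrier_matD[OF B]] i0(1) u(1)
      by (intro sum_mono mult_right_mono) auto
    finally have "\<bar>x i0\<bar> \<le> c * (\<Sum>j<n. u j)" by (simp add: sum_distrib_left)
    moreover have "q ^ k * u i0 \<le> x i0" using x(2) i0 by blast
    ultimately show ?thesis by linarith
  qed
  obtain k where "c * (\<Sum>j<n. u j) / u i0 < q ^ k"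
    using real_arch_pow[OF q] by blast
  then show False using bnd[of k] i0(2) by (simp add: divide_less_eq)
qed

section \<open>Subinvariant vectors of the ratio matrix as functions on the vertices\<close>

context fin_digraph
begin

lemma vertex_enum_bij: "bij_betw (vertex_enum G) {..<card (verts G)} (verts G)"
proof -
  have "\<exists>f. bij_betw f {0..<card (verts G)} (verts G)"
    by (rule ex_bij_betw_nat_finite) simp
  then have "bij_betw (vertex_enum G) {0..<card (verts G)} (verts G)"
    unfolding vertex_enum_def by (rule someI_ex)
  then show ?thesis by (simp add: lessThan_atLeast0)
qed

lemma ratio_matrix_real_mat:
  "ratio_matrix G r s = real_mat (card (verts G))
     (\<lambda>k l. \<Sum>e | e \<in> out_arcs G (vertex_enum G k) \<and> head G e = vertex_enum G l. r e powr s)"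
  by (simp add: ratio_matrix_def real_mat_def)

lemma sum_over_heads:
  fixes w :: "'a \<Rightarrow> real"
  shows "(\<Sum>l<card (verts G).
      (\<Sum>e | e \<in> out_arcs G i \<and> head G e = vertex_enum G l. r e powr s) * w (vertex_enum G l))
    = (\<Sum>e\<in>out_arcs G i. r e powr s * w (head G e))"
proof -
  have "(\<Sum>e\<in>out_arcs G i. r e powr s * w (head G e))
      = (\<Sum>j\<in>verts G. \<Sum>e | e \<in> out_arcs G i \<and> head G e = j. r e powr s * w (head G e))"
    by (rule sum.group[symmetric]) auto
  also have "\<dots> = (\<Sum>j\<in>verts G. (\<Sum>e | e \<in> out_arcs G i \<and> head G e = j. r e powr s) * w j)"
    by (simp add: sum_distrib_right)
  also have "\<dots> = (\<Sum>l<card (verts G).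
      (\<Sum>e | e \<in> out_arcs G i \<and> head G e = vertex_enum G l. r e powr s) * w (vertex_enum G l))"
    using sum.reindex_bij_betw[OF vertex_enum_bij,
        of "\<lambda>j. (\<Sum>e | e \<in> out_arcs G i \<and> head G e = j. r e powr s) * w j"] by simp
  finally show ?thesis by simp
qed

lemma ratio_matrix_subinvariant:
  assumes "verts G \<noteq> {}"
  obtains w :: "'a \<Rightarrow> real" where "\<And>i. i \<in> verts G \<Longrightarrow> 0 \<le> w i" and "\<exists>i\<in>verts G. 0 < w i"
    and "\<And>i. i \<in> verts G \<Longrightarrow> spectral_radius (ratio_matrix G r s) * w i
           \<le> (\<Sum>e\<in>out_arcs G i. r e powr s * w (head G e))"
proof -
  let ?f = "vertex_enum G" and ?n = "card (verts G)"
  have "0 < ?n" using assms by (simp add: card_gt_0_iff)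
  then obtain u where u: "\<And>i. 0 \<le> u i" "\<exists>i<?n. 0 < u i"
    "\<And>k. k < ?n \<Longrightarrow> spectral_radius (ratio_matrix G r s) * u k
       \<le> (\<Sum>l<?n. (\<Sum>e | e \<in> out_arcs G (?f k) \<and> head G e = ?f l. r e powr s) * u l)"
    unfolding ratio_matrix_real_mat
    by (rule spectral_radius_subinvariant[where a = "\<lambda>k l.
        \<Sum>e | e \<in> out_arcs G (?f k) \<and> head G e = ?f l. r e powr s"])
      (auto intro: sum_nonneg)
  define w where "w i = u (inv_into {..<?n} ?f i)" for i
  have w: "w (?f k) = u k" if "k < ?n" for k
    using that bij_betw_inv_into_left[OF vertex_enum_bij, of k] by (simp add: w_def)
  have ex: "\<exists>k<?n. i = ?f k" if "i \<in> verts G" for i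
    using that vertex_enum_bij by (auto simp: bij_betw_def)
  have f: "?f k \<in> verts G" if "k < ?n" for k
    using that vertex_enum_bij by (auto simp: bij_betw_def)
  show ?thesis
  proof
    show "0 \<le> w i" for i by (simp add: w_def u)
    show "\<exists>i\<in>verts G. 0 < w i" using u(2) w f by metis
    fix i assume "i \<in> verts G"
    then obtain k where k: "k < ?n" "i = ?f k" using ex by blast
    have "spectral_radius (ratio_matrix G r s) * w i
       \<le> (\<Sum>l<?n. (\<Sum>e | e \<in> out_arcs G i \<and> head G e = ?f l. r e powr s) * w (?f l))"
      using u(3)[OF k(1)] k w by simp
    then show "spectral_radius (ratio_matrix G r s) * w i
       \<le> (\<Sum>e\<in>out_arcs G i. r e powr s * w (head G e))"
      by (simp only: sum_over_heads)
  qed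
qed

lemma spectral_radius_ratio_matrix_ge:
  assumes "\<And>i. i \<in> verts G \<Longrightarrow> 0 \<le> w i" and "\<exists>i\<in>verts G. 0 < w i"
    and "\<And>i. i \<in> verts G \<Longrightarrow> l * w i \<le> (\<Sum>e\<in>out_arcs G i. r e powr s * w (head G e))"
  shows "l \<le> spectral_radius (ratio_matrix G r s)"
proof -
  let ?f = "vertex_enum G" and ?n = "card (verts G)"
  have ex: "\<exists>k<?n. i = ?f k" if "i \<in> verts G" for i
    using that vertex_enum_bij by (auto simp: bij_betw_def)
  have f: "?f k \<in> verts G" if "k < ?n" for k
    using that vertex_enum_bij by (auto simp: bij_betw_def)
  show ?thesis
    unfolding ratio_matrix_real_mat
  proof (rule spectral_radius_ge[where u = "\<lambda>k. w (?f k)"])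
    show "\<exists>k<?n. 0 < w (?f k)" using assms(2) ex by metis
    show "l * w (?f k)
       \<le> (\<Sum>j<?n. (\<Sum>e | e \<in> out_arcs G (?f k) \<and> head G e = ?f j. r e powr s) * w (?f j))"
      if "k < ?n" for k
      using assms(3)[OF f[OF that]] by (simp only: sum_over_heads)
  qed (auto intro: sum_nonneg assms f)
qed

end

section \<open>The exponent\<close>

context mauldin_williams_graph
begin

lemma path_exists:
  assumes "mw_strongly_connected G" "i \<in> verts G" "j \<in> verts G"
  obtains p where "p \<noteq> []" "awalk i p j"
proof -
  obtain p where "length p \<ge> 1" "awalk i p j"
    using assms unfolding mw_strongly_connected_def by blast
  then show ?thesis using that[of p] by fastforce
qed

lemma out_arcs_nonempty:
  assumes "mw_strongly_connected G" "i \<in> verts G"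
  shows "out_arcs G i \<noteq> {}"
proof -
  obtain p where p: "p \<noteq> []" "awalk i p i" using path_exists[OF assms assms(2)] by blast
  then obtain e q where "p = e # q" by (cases p) auto
  then show ?thesis using p(2) by (auto simp: awalk_Cons_iff)
qed

lemma ratio_bounds:
  obtains m \<rho> where "0 < m" "m \<le> \<rho>" "\<rho> < 1" "\<And>e. e \<in> arcs G \<Longrightarrow> m \<le> r e \<and> r e \<le> \<rho>"
proof -
  \<comment> \<open>The extra value \<open>1/2\<close> keeps minimum and maximum defined, and
    strictly between 0 and 1, even for an empty edge set.\<close>
  let ?R = "insert (1/2) (r ` arcs G)"
  have fin: "finite ?R" by simp
  have "Min ?R \<in> ?R" "Max ?R \<in> ?R" using Min_in[OF fin] Max_in[OF fin] by blast+
  then have "0 < Min ?R" "Max ?R < 1" using ratio_pos ratio_less_one by (auto simp del: Min_insert Max_insert)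
  moreover have "Min ?R \<le> Max ?R" using fin by (intro order.trans[OF Min_le Max_ge, of _ "1/2"]) auto
  moreover have "Min ?R \<le> r e \<and> r e \<le> Max ?R" if "e \<in> arcs G" for e
    using fin that by (auto simp del: Min_insert Max_insert intro!: Min_le Max_ge)
  ultimately show ?thesis using that[of "Min ?R" "Max ?R"] by blast
qed

context
  assumes sc: "mw_strongly_connected G" and ne: "verts G \<noteq> {}"
begin

lemma spectral_radius_nonneg: "0 \<le> spectral_radius (ratio_matrix G r s)"
proof -
  have "0 < card (verts G)" using ne by (simp add: card_gt_0_iff)
  then have "spectral_radius (ratio_matrix G r s) \<in> norm ` spectrum (ratio_matrix G r s)"
    unfolding ratio_matrix_real_mat by (intro spectral_radius_mem_max(1)[OF real_mat_carrier])
  then show ?thesis by auto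
qed

text \<open>A subinvariant vector at exponent \<open>s\<close> is tested at exponent
  \<open>s + d\<close>: each weight changes by the factor \<open>r e powr d\<close>, which is at
  least \<open>m powr d\<close>.\<close>

lemma spectral_radius_lower:
  assumes m: "0 < m" "\<And>e. e \<in> arcs G \<Longrightarrow> m \<le> r e" and "0 \<le> d"
  shows "m powr d * spectral_radius (ratio_matrix G r s) \<le> spectral_radius (ratio_matrix G r (s + d))"
proof -
  obtain w where w: "\<And>i. i \<in> verts G \<Longrightarrow> 0 \<le> w i" "\<exists>i\<in>verts G. 0 < w i"
    "\<And>i. i \<in> verts G \<Longrightarrow> spectral_radius (ratio_matrix G r s) * w i
           \<le> (\<Sum>e\<in>out_arcs G i. r e powr s * w (head G e))"
    by (rule ratio_matrix_subinvariant[OF ne, of r s]) blast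
  show ?thesis
  proof (rule spectral_radius_ratio_matrix_ge[OF w(1,2)])
    fix i assume i: "i \<in> verts G"
    have "m powr d * spectral_radius (ratio_matrix G r s) * w i
        \<le> m powr d * (\<Sum>e\<in>out_arcs G i. r e powr s * w (head G e))"
      using w(3)[OF i] by (simp add: mult.assoc mult_left_mono)
    also have "\<dots> = (\<Sum>e\<in>out_arcs G i. m powr d * (r e powr s * w (head G e)))"
      by (simp add: sum_distrib_left)
    also have "\<dots> \<le> (\<Sum>e\<in>out_arcs G i. r e powr d * (r e powr s * w (head G e)))"
      using m \<open>0 \<le> d\<close> w(1) by (intro sum_mono mult_right_mono powr_mono2) auto
    also have "\<dots> = (\<Sum>e\<in>out_arcs G i. r e powr (s + d) * w (head G e))"
      by (simp add: powr_add mult_ac)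
    finally show "m powr d * spectral_radius (ratio_matrix G r s) * w i
        \<le> (\<Sum>e\<in>out_arcs G i. r e powr (s + d) * w (head G e))" .
  qed
qed

text \<open>The same comparison in the other direction: a subinvariant vector at exponent
  \<open>s + d\<close> is tested at exponent \<open>s\<close>.\<close>

lemma spectral_radius_upper:
  assumes m: "0 < \<rho>" "\<And>e. e \<in> arcs G \<Longrightarrow> r e \<le> \<rho>" and "0 \<le> d"
  shows "spectral_radius (ratio_matrix G r (s + d)) \<le> \<rho> powr d * spectral_radius (ratio_matrix G r s)"
proof -
  let ?f = "\<lambda>s. spectral_radius (ratio_matrix G r s)"
  obtain w where w: "\<And>i. i \<in> verts G \<Longrightarrow> 0 \<le> w i" "\<exists>i\<in>verts G. 0 < w i"
    "\<And>i. i \<in> verts G \<Longrightarrow> ?f (s + d) * w i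
           \<le> (\<Sum>e\<in>out_arcs G i. r e powr (s + d) * w (head G e))"
    by (rule ratio_matrix_subinvariant[OF ne, of r "s + d"]) blast
  have "\<rho> powr - d * ?f (s + d) \<le> ?f s"
  proof (rule spectral_radius_ratio_matrix_ge[OF w(1,2)])
    fix i assume i: "i \<in> verts G"
    have "\<rho> powr - d * ?f (s + d) * w i
        \<le> \<rho> powr - d * (\<Sum>e\<in>out_arcs G i. r e powr (s + d) * w (head G e))"
      using w(3)[OF i] by (simp add: mult.assoc mult_left_mono)
    also have "\<dots> = (\<Sum>e\<in>out_arcs G i. \<rho> powr - d * (r e powr d * (r e powr s * w (head G e))))"
      by (simp add: sum_distrib_left powr_add mult_ac)
    also have "\<dots> \<le> (\<Sum>e\<in>out_arcs G i. \<rho> powr - d * (\<rho> powr d * (r e powr s * w (head G e))))"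
      using m \<open>0 \<le> d\<close> w(1) ratio_pos
      by (intro sum_mono mult_right_mono mult_left_mono powr_mono2) (auto intro: less_imp_le)
    also have "\<dots> = (\<Sum>e\<in>out_arcs G i. r e powr s * w (head G e))"
      using m(1) by (simp add: powr_minus field_simps)
    finally show "\<rho> powr - d * ?f (s + d) * w i
        \<le> (\<Sum>e\<in>out_arcs G i. r e powr s * w (head G e))" .
  qed
  then show ?thesis using m(1) by (simp add: powr_minus field_simps)
qed

text \<open>The two comparisons squeeze the value at \<open>x\<close> between multiples of the value
  at \<open>s\<close> whose factors tend to 1 as \<open>x\<close> tends to \<open>s\<close>.\<close>

lemma spectral_radius_continuous: "isCont (\<lambda>s. spectral_radius (ratio_matrix G r s)) s"
proof -
  let ?f = "\<lambda>s. spectral_radius (ratio_matrix G r s)"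
  obtain m \<rho> where b: "0 < m" "m \<le> \<rho>" "\<rho> < 1" "\<And>e. e \<in> arcs G \<Longrightarrow> m \<le> r e \<and> r e \<le> \<rho>"
    using ratio_bounds by blast
  have lo: "m powr d * ?f x \<le> ?f (x + d)" if "0 \<le> d" for x d
    using spectral_radius_lower[of m d x] b that by auto
  \<comment> \<open>With 1 as the bound on the ratios, this is plain monotonicity.\<close>
  have up: "?f (x + d) \<le> 1 powr d * ?f x" if "0 \<le> d" for x d
    using spectral_radius_upper[of 1 d x] b that by fastforce
  have le1: "m powr d \<le> 1" if "0 \<le> d" for d
    using powr_mono2[of d m 1] b that by auto
  have bounds: "m powr \<bar>x - s\<bar> * ?f s \<le> ?f x \<and> ?f x \<le> m powr - \<bar>x - s\<bar> * ?f s" for x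
  proof (cases "s \<le> x")
    case True
    have "1 \<le> m powr - (x - s)"
      using le1[of "x - s"] True b(1) by (simp only: powr_minus one_le_inverse_iff) auto
    then have "1 * ?f s \<le> m powr - (x - s) * ?f s"
      using spectral_radius_nonneg[of s] by (rule mult_right_mono)
    then show ?thesis using lo[of "x - s" s] up[of "x - s" s] True by simp
  next
    case False
    have "m powr (s - x) * ?f s \<le> ?f s"
      using le1[of "s - x"] False spectral_radius_nonneg[of s] by (simp add: mult_left_le_one_le)
    moreover have "?f x \<le> m powr - (s - x) * ?f s"
    proof -
      have "m powr - (s - x) * (m powr (s - x) * ?f x) \<le> m powr - (s - x) * ?f s"
        using lo[of "s - x" x] False by (intro mult_left_mono) auto
      moreover have "m powr - (s - x) * (m powr (s - x) * ?f x) = ?f x"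
        using b(1) by (simp only: mult.assoc[symmetric] powr_add[symmetric]) simp
      ultimately show ?thesis by linarith
    qed
    ultimately show ?thesis using up[of "s - x" x] False by simp
  qed
  have "(?f \<longlongrightarrow> ?f s) (at s)"
  proof (rule tendsto_sandwich)
    show "\<forall>\<^sub>F x in at s. m powr \<bar>x - s\<bar> * ?f s \<le> ?f x" using bounds by simp
    show "\<forall>\<^sub>F x in at s. ?f x \<le> m powr - \<bar>x - s\<bar> * ?f s" using bounds by simp
    show "((\<lambda>x. m powr \<bar>x - s\<bar> * ?f s) \<longlongrightarrow> ?f s) (at s)"
      using b(1) by (auto intro!: tendsto_eq_intros)
    show "((\<lambda>x. m powr - \<bar>x - s\<bar> * ?f s) \<longlongrightarrow> ?f s) (at s)"
      using b(1) by (auto intro!: tendsto_eq_intros)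
  qed
  then show ?thesis by (simp add: isCont_def)
qed

text \<open>At exponent 0 the matrix counts edges, and strong connectivity gives every vertex an
  outgoing edge, so the constant vector 1 is subinvariant.\<close>

lemma spectral_radius_zero_ge: "1 \<le> spectral_radius (ratio_matrix G r 0)"
proof (rule spectral_radius_ratio_matrix_ge[where w = "\<lambda>_. 1"])
  fix i assume "i \<in> verts G"
  then have "0 < card (out_arcs G i)"
    using out_arcs_nonempty[OF sc] finite_out_arcs[of i] by (simp add: card_gt_0_iff del: in_out_arcs_conv)
  moreover have "(\<Sum>e\<in>out_arcs G i. r e powr 0) = (\<Sum>e\<in>out_arcs G i. 1)"
    using ratio_pos by (intro sum.cong) force+
  ultimately show "1 * (1::real) \<le> (\<Sum>e\<in>out_arcs G i. r e powr 0 * 1)"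
    by simp
qed (use ne in auto)

text \<open>Existence is the intermediate value theorem between 0 and a large exponent, where the
  geometric decay has pushed the value below 1. For uniqueness, the same decay makes the value less
  than 1 to the right of any solution.\<close>

lemma exponent_unique_existence: "\<exists>!s. s \<ge> 0 \<and> spectral_radius (ratio_matrix G r s) = 1"
proof -
  let ?f = "\<lambda>s. spectral_radius (ratio_matrix G r s)"
  obtain m \<rho> where b: "0 < m" "m \<le> \<rho>" "\<rho> < 1" "\<And>e. e \<in> arcs G \<Longrightarrow> m \<le> r e \<and> r e \<le> \<rho>"
    using ratio_bounds by blast
  have up: "?f (x + d) \<le> \<rho> powr d * ?f x" if "0 \<le> d" for x d
    using spectral_radius_upper[of \<rho> d x] b that by auto
  have "((\<lambda>d. \<rho> powr d * ?f 0) \<longlongrightarrow> 0 * ?f 0) at_top"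
    using b by (intro tendsto_mult tendsto_const) real_asymp
  then have "\<forall>\<^sub>F d in at_top. \<rho> powr d * ?f 0 < 1"
    by (intro order_tendstoD) auto
  then obtain d where d: "0 \<le> d" "\<rho> powr d * ?f 0 < 1"
    unfolding eventually_at_top_linorder using max.cobounded1 max.cobounded2 by blast
  then have "?f d \<le> 1" using up[of d 0] by simp
  then obtain s where s: "0 \<le> s" "?f s = 1"
    using IVT2[of ?f d 1 0] d(1) spectral_radius_zero_ge spectral_radius_continuous by auto
  have less: "?f y < 1" if "x < y" "?f x = 1" for x y
  proof -
    have "?f y \<le> \<rho> powr (y - x)" using up[of "y - x" x] that by simp
    also have "\<dots> < 1" using b that using powr_less_mono2[of "y - x" \<rho> 1] by simp
    finally show ?thesis .
  qed
  show ?thesis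
  proof (rule ex1I[of _ s])
    show "t = s" if "0 \<le> t \<and> ?f t = 1" for t
      using less[of s t] less[of t s] s that by (cases s t rule: linorder_cases) auto
  qed (use s in auto)
qed

lemma s0_nonneg: "0 \<le> s0 G r" and spectral_radius_s0: "spectral_radius (ratio_matrix G r (s0 G r)) = 1"
  using theI'[OF exponent_unique_existence] by (auto simp: s0_def)

text \<open>Iterating \<open>u \<mapsto> u + A u\<close> keeps a vector subinvariant and spreads its support along paths.\<close>

lemma positive_subinvariant:
  obtains v where "\<And>i. i \<in> verts G \<Longrightarrow> 0 < v i"
    and "\<And>i. i \<in> verts G \<Longrightarrow> v i \<le> (\<Sum>e\<in>out_arcs G i. r e powr s0 G r * v (head G e))"
proof -
  define A where "A w i = (\<Sum>e\<in>out_arcs G i. r e powr s0 G r * w (head G e))" for w :: "'v \<Rightarrow> real" and i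
  obtain w where w: "\<And>i. i \<in> verts G \<Longrightarrow> 0 \<le> w i" "\<exists>i\<in>verts G. 0 < w i"
    "\<And>i. i \<in> verts G \<Longrightarrow> w i \<le> A w i"
    using ratio_matrix_subinvariant[OF ne, of r "s0 G r" thesis]
    unfolding spectral_radius_s0 mult_1 A_def by blast
  define W where "W = rec_nat w (\<lambda>_ u i. u i + A u i)"
  have W0: "W 0 = w" and WS: "W (Suc n) i = W n i + A (W n) i" for n i
    by (auto simp: W_def)
  have nn: "0 \<le> W n i" if "i \<in> verts G" for n i
    using that
  proof (induction n arbitrary: i)
    case (Suc n)
    then show ?case by (auto simp: WS A_def intro!: add_nonneg_nonneg sum_nonneg)
  qed (simp add: W0 w)
  have Ann: "0 \<le> A (W n) i" for n i
    using nn by (auto simp: A_def intro!: sum_nonneg)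
  have sub: "W n i \<le> A (W n) i" if "i \<in> verts G" for n i
    using that
  proof (induction n arbitrary: i)
    case (Suc n)
    have "A (W (Suc n)) i = A (W n) i + A (A (W n)) i"
      by (simp add: WS A_def sum.distrib distrib_left)
    moreover have "A (W n) i \<le> A (A (W n)) i"
      unfolding A_def[of "W n" i] A_def[of "A (W n)" i]
      by (intro sum_mono mult_left_mono Suc.IH) auto
    moreover have "W (Suc n) i = W n i + A (W n) i" by (rule WS)
    ultimately show ?case using Suc.IH[OF Suc.prems] by linarith
  qed (simp add: W0 w)
  have mono: "W n i \<le> W (n + k) i" for n k i
  proof (induction k)
    case (Suc k)
    then show ?case using Ann[of "n + k" i] by (simp add: WS)
  qed simp
  have spread: "0 < W (length p) i" if "awalk i p j" "0 < w j" for i p j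
    using that
  proof (induction p arbitrary: i)
    case Nil
    then show ?case by (simp add: W0 awalk_Nil_iff)
  next
    case (Cons e p)
    then have e: "e \<in> out_arcs G i" and "0 < W (length p) (head G e)"
      by (auto simp: awalk_Cons_iff)
    then have "0 < r e powr s0 G r * W (length p) (head G e)" using ratio_pos by force
    also have "\<dots> \<le> A (W (length p)) i"
      unfolding A_def using nn by (intro member_le_sum[OF e]) auto
    finally show ?case using nn[of i "length p"] Cons.prems(1)
      by (auto simp: WS awalk_Cons_iff intro!: add_nonneg_pos)
  qed
  obtain j where j: "j \<in> verts G" "0 < w j" using w(2) by blast
  have "\<forall>i\<in>verts G. \<exists>n. 0 < W n i"
  proof
    fix i assume "i \<in> verts G"
    then obtain p where "awalk i p j" using path_exists[OF sc _ j(1)] by metis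
    then show "\<exists>n. 0 < W n i" using spread j(2) by blast
  qed
  then obtain n where n: "\<And>i. i \<in> verts G \<Longrightarrow> 0 < W (n i) i" by metis
  \<comment> \<open>By \<open>mono\<close>, positivity once reached persists, so the largest of the
    finitely many stages serves all vertices.\<close>
  define N where "N = Max (n ` verts G)"
  have "0 < W N i" if "i \<in> verts G" for i
  proof -
    have "n i \<le> N" using that by (simp add: N_def)
    then show ?thesis using n[OF that] mono[of "n i" i "N - n i"] by simp
  qed
  then show ?thesis using that[of "W N"] sub unfolding A_def by blast
qed

end

end

section \<open>Path maps and attractors\<close>

context mauldin_williams_graph
begin

definition path_map :: "'e list \<Rightarrow> 'a \<Rightarrow> 'a" where
  "path_map p = foldr (\<lambda>e f. S e \<circ> f) p id"

definition path_ratio :: "'e list \<Rightarrow> real" where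
  "path_ratio p = prod_list (map r p)"

lemma path_map_simps [simp]:
  "path_map [] = id" "path_map (e # p) = S e \<circ> path_map p"
  by (simp_all add: path_map_def)

lemma path_ratio_simps [simp]:
  "path_ratio [] = 1" "path_ratio (e # p) = r e * path_ratio p"
  by (simp_all add: path_ratio_def)

lemma path_map_append: "path_map (p @ q) = path_map p \<circ> path_map q"
  by (induction p) (auto simp: comp_assoc)

lemma path_ratio_append: "path_ratio (p @ q) = path_ratio p * path_ratio q"
  by (simp add: path_ratio_def)

lemma path_ratio_pos: "awalk i p j \<Longrightarrow> 0 < path_ratio p"
  by (induction p arbitrary: i) (auto simp: awalk_Cons_iff ratio_pos)

lemma path_ratio_le_power:
  assumes "\<And>e. e \<in> arcs G \<Longrightarrow> r e \<le> \<rho>"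
  shows "awalk i p j \<Longrightarrow> path_ratio p \<le> \<rho> ^ length p"
proof (induction p arbitrary: i)
  case (Cons e p)
  then show ?case
    using assms[of e] ratio_pos[of e] path_ratio_pos[of "head G e" p j]
    by (auto simp: awalk_Cons_iff intro!: mult_mono)
qed simp

lemma path_map_in: "awalk i p j \<Longrightarrow> x \<in> X j \<Longrightarrow> path_map p x \<in> X i"
proof (induction p arbitrary: i)
  case (Cons e p)
  then show ?case using map_into[of e] by (auto simp: awalk_Cons_iff)
qed (auto simp: awalk_Nil_iff)

lemma dist_path_map:
  "awalk i p j \<Longrightarrow> x \<in> X j \<Longrightarrow> y \<in> X j \<Longrightarrow>
    dist (path_map p x) (path_map p y) = path_ratio p * dist x y"
proof (induction p arbitrary: i)
  case (Cons e p)
  then show ?case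
    by (auto simp: awalk_Cons_iff map_similarity path_map_in)
qed (auto simp: awalk_Nil_iff)

lemma continuous_on_path_map:
  assumes "awalk i p j"
  shows "continuous_on (X j) (path_map p)"
proof -
  have "(path_ratio p)-lipschitz_on (X j) (path_map p)"
    using dist_path_map[OF assms] path_ratio_pos[OF assms] by (auto simp: lipschitz_on_def)
  then show ?thesis by (rule lipschitz_on_continuous_on)
qed

lemma inj_on_path_map: "awalk i p j \<Longrightarrow> inj_on (path_map p) (X j)"
  using dist_path_map path_ratio_pos
  by (intro inj_onI) (metis dist_eq_0_iff less_irrefl mult_eq_0_iff)

lemma continuous_on_arc: "e \<in> arcs G \<Longrightarrow> continuous_on (X (head G e)) (S e)"
  using continuous_on_path_map[OF arc_implies_awalk] by simp

lemma inj_on_arc: "e \<in> arcs G \<Longrightarrow> inj_on (S e) (X (head G e))"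
  using inj_on_path_map[OF arc_implies_awalk] by simp

lemma diameter_bound:
  obtains D where "0 < D" "\<And>i x y. i \<in> verts G \<Longrightarrow> x \<in> X i \<Longrightarrow> y \<in> X i \<Longrightarrow> dist x y \<le> D"
proof
  let ?D = "diameter (\<Union>i\<in>verts G. X i)"
  have b: "bounded (\<Union>i\<in>verts G. X i)"
    using space_compact compact_imp_bounded by (intro bounded_UN) auto
  then show "0 < ?D + 1" using diameter_ge_0[OF b] by simp
  show "dist x y \<le> ?D + 1" if "i \<in> verts G" "x \<in> X i" "y \<in> X i" for i x y
    using diameter_bounded_bound[OF b, of x y] that by fastforce
qed

end

section \<open>Existence and uniqueness of the attractors\<close>

context inhom_mauldin_williams_graph
begin

text \<open>The iterates of the defining set operator, started from the full spaces. They form a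
  decreasing sequence of compact sets, and the attractor will be their intersection.\<close>

primrec approximant :: "nat \<Rightarrow> 'v \<Rightarrow> 'a set" where
  "approximant 0 = X"
| "approximant (Suc n) = (\<lambda>i. C i \<union> (\<Union>e\<in>out_arcs G i. S e ` approximant n (head G e)))"

lemma approximant_Suc:
  "approximant (Suc n) i = C i \<union> (\<Union>e\<in>out_arcs G i. S e ` approximant n (head G e))"
  by simp

text \<open>The condition under the description operator in \<open>inhom_attractor\<close>, without
  the normalisation off the vertex set.\<close>

definition is_attractor :: "('v \<Rightarrow> 'a set) \<Rightarrow> bool" where
  "is_attractor K \<longleftrightarrow> (\<forall>i\<in>verts G. K i \<noteq> {} \<and> compact (K i) \<and> K i \<subseteq> X i \<and>
     K i = C i \<union> (\<Union>e\<in>out_arcs G i. S e ` K (head G e)))"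

lemma is_attractorD:
  assumes "is_attractor K" "i \<in> verts G"
  shows "K i \<noteq> {}" "compact (K i)" "K i \<subseteq> X i"
    "K i = C i \<union> (\<Union>e\<in>out_arcs G i. S e ` K (head G e))"
  using assms unfolding is_attractor_def by blast+

lemma head_out_arcs: "e \<in> out_arcs G i \<Longrightarrow> head G e \<in> verts G"
  by auto

lemma approximant_subset: "i \<in> verts G \<Longrightarrow> approximant n i \<subseteq> X i"
proof (induction n arbitrary: i)
  case (Suc n)
  have "S e ` approximant n (head G e) \<subseteq> X i" if "e \<in> out_arcs G i" for e
    using Suc.IH[OF head_out_arcs[OF that]] map_into[of e] that by auto
  then show ?case using condensation_subset[OF Suc.prems] unfolding approximant_Suc by blast
qed simp

lemma approximant_decreasing: "i \<in> verts G \<Longrightarrow> approximant (Suc n) i \<subseteq> approximant n i"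
proof (induction n arbitrary: i)
  case 0
  then show ?case using approximant_subset[of i "Suc 0"] by simp
next
  case (Suc n)
  have "approximant (Suc (Suc n)) i
      = C i \<union> (\<Union>e\<in>out_arcs G i. S e ` approximant (Suc n) (head G e))"
    by (rule approximant_Suc)
  also have "\<dots> \<subseteq> C i \<union> (\<Union>e\<in>out_arcs G i. S e ` approximant n (head G e))"
    by (intro Un_mono UN_mono image_mono Suc.IH head_out_arcs) simp_all
  also have "\<dots> = approximant (Suc n) i" by (rule approximant_Suc[symmetric])
  finally show ?case .
qed

lemma approximant_antimono: "i \<in> verts G \<Longrightarrow> m \<le> n \<Longrightarrow> approximant n i \<subseteq> approximant m i"
  by (rule lift_Suc_antimono_le[of "\<lambda>n. approximant n i", OF approximant_decreasing])

lemma approximant_compact: "i \<in> verts G \<Longrightarrow> compact (approximant n i)"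
proof (induction n arbitrary: i)
  case 0
  then show ?case by (simp add: space_compact)
next
  case (Suc n)
  have "compact (S e ` approximant n (head G e))" if "e \<in> out_arcs G i" for e
    using that Suc.IH[OF head_out_arcs[OF that]] approximant_subset[OF head_out_arcs[OF that]]
    by (intro compact_continuous_image continuous_on_subset[OF continuous_on_arc]) auto
  then show ?case
    using condensation_compact[OF Suc.prems] finite_out_arcs[of i]
    by (auto simp del: in_out_arcs_conv intro!: compact_Un compact_UN)
qed

lemma approximant_nonempty:
  "mw_strongly_connected G \<Longrightarrow> i \<in> verts G \<Longrightarrow> approximant n i \<noteq> {}"
proof (induction n arbitrary: i)
  case (Suc n)
  obtain e where "e \<in> out_arcs G i" using out_arcs_nonempty Suc.prems by blast
  then show ?case using Suc.IH[OF Suc.prems(1) head_out_arcs] by fastforce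
qed (simp add: space_nonempty)

text \<open>The point is to exchange the intersection over stages with the union over edges. There
  are finitely many edges and the stages decrease: if every edge failed to reach \<open>x\<close> at
  some stage, all would fail at the largest of these stages.\<close>

lemma is_attractor_Inter_approximant:
  assumes sc: "mw_strongly_connected G"
  shows "is_attractor (\<lambda>i. \<Inter>n. approximant n i)"
  unfolding is_attractor_def
proof (intro ballI conjI)
  fix i assume i: "i \<in> verts G"
  show "(\<Inter>n. approximant n i) \<noteq> {}"
    using approximant_compact[OF i] approximant_nonempty[OF sc i] approximant_antimono[OF i]
    by (intro compact_nest) auto
  show "compact (\<Inter>n. approximant n i)"
    using approximant_compact[OF i] by (intro compact_Inter) auto
  show "(\<Inter>n. approximant n i) \<subseteq> X i" using approximant_subset[OF i] by blast
  show "(\<Inter>n. approximant n i) = C i \<union> (\<Union>e\<in>out_arcs G i. S e ` (\<Inter>n. approximant n (head G e)))"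
    (is "?L = ?R")
  proof
    show "?R \<subseteq> ?L"
    proof
      fix x assume "x \<in> ?R"
      then have "x \<in> approximant (Suc n) i" for n by auto
      then show "x \<in> ?L" using approximant_decreasing[OF i] by blast
    qed
    show "?L \<subseteq> ?R"
    proof
      fix x assume x: "x \<in> ?L"
      show "x \<in> ?R"
      proof (cases "x \<in> C i")
        case False
        have "\<exists>e\<in>out_arcs G i. \<forall>n. x \<in> S e ` approximant n (head G e)"
        proof (rule ccontr)
          assume "\<not> ?thesis"
          then obtain N where N: "\<And>e. e \<in> out_arcs G i \<Longrightarrow> x \<notin> S e ` approximant (N e) (head G e)"
            by metis
          define M where "M = Max (insert 0 (N ` out_arcs G i))"
          have "x \<in> approximant (Suc M) i" using x by blast
          then obtain e where e: "e \<in> out_arcs G i" "x \<in> S e ` approximant M (head G e)"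
            using False by auto
          have "N e \<le> M" using e(1) finite_out_arcs[of i] by (auto simp: M_def simp del: in_out_arcs_conv)
          then show False
            using N[OF e(1)] e approximant_antimono[OF head_out_arcs[OF e(1)]] by blast
        qed
        then obtain e where e: "e \<in> out_arcs G i" "\<And>n. x \<in> S e ` approximant n (head G e)"
          by blast
        obtain y where y: "y \<in> X (head G e)" "x = S e y" using e(2)[of 0] by auto
        \<comment> \<open>Each stage supplies its own preimage of \<open>x\<close>; injectivity of
          \<open>S e\<close> on the space identifies it with \<open>y\<close>.\<close>
        have "y \<in> approximant n (head G e)" for n
        proof -
          obtain z where "z \<in> approximant n (head G e)" "S e z = S e y" using e(2)[of n] y(2) by auto
          moreover have "z \<in> X (head G e)"
            using approximant_subset[OF head_out_arcs[OF e(1)]] calculation by blast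
          ultimately show ?thesis using inj_on_arc[of e] e(1) y(1) by (auto dest: inj_onD)
        qed
        then show ?thesis using e(1) y(2) by blast
      qed simp
    qed
  qed
qed

text \<open>Induction puts \<open>K\<close> inside every stage. Conversely, by contraction each
  point of stage \<open>n\<close> lies within \<open>\<rho> ^ n * D\<close> of \<open>K\<close>, so
  a point of all stages lies in the closed set \<open>K\<close>.\<close>

lemma is_attractor_unique:
  assumes K: "is_attractor K" and i: "i \<in> verts G"
  shows "K i = (\<Inter>n. approximant n i)"
proof
  have "K i \<subseteq> approximant n i" for n
    using i
  proof (induction n arbitrary: i)
    case (Suc n)
    have "K i = C i \<union> (\<Union>e\<in>out_arcs G i. S e ` K (head G e))"
      by (rule is_attractorD(4)[OF K Suc.prems(1)])
    also have "\<dots> \<subseteq> C i \<union> (\<Union>e\<in>out_arcs G i. S e ` approximant n (head G e))"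
      by (intro Un_mono UN_mono image_mono Suc.IH head_out_arcs) simp_all
    also have "\<dots> = approximant (Suc n) i" by (rule approximant_Suc[symmetric])
    finally show ?case .
  qed (simp add: is_attractorD(3)[OF K])
  then show "K i \<subseteq> (\<Inter>n. approximant n i)" by blast
  obtain D where D: "0 < D" "\<And>i x y. i \<in> verts G \<Longrightarrow> x \<in> X i \<Longrightarrow> y \<in> X i \<Longrightarrow> dist x y \<le> D"
    using diameter_bound by blast
  obtain m \<rho> where \<rho>: "0 < m" "m \<le> \<rho>" "\<rho> < 1" "\<And>e. e \<in> arcs G \<Longrightarrow> m \<le> r e \<and> r e \<le> \<rho>"
    using ratio_bounds by blast
  have near: "\<exists>y\<in>K i. dist x y \<le> \<rho> ^ n * D" if "i \<in> verts G" "x \<in> approximant n i" for i x n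
    using that
  proof (induction n arbitrary: i x)
    case 0
    then obtain y where "y \<in> K i" "y \<in> X i" using is_attractorD(1,3)[OF K 0(1)] by blast
    then show ?case using D(2) 0 by auto
  next
    case (Suc n)
    have Ki: "K i = C i \<union> (\<Union>e\<in>out_arcs G i. S e ` K (head G e))"
      by (rule is_attractorD(4)[OF K Suc.prems(1)])
    show ?case
    proof (cases "x \<in> C i")
      case True
      then show ?thesis using Ki \<rho> D by (intro bexI[of _ x]) auto
    next
      case False
      then obtain e z where e: "e \<in> out_arcs G i" and z: "z \<in> approximant n (head G e)" "x = S e z"
        using Suc.prems by auto
      obtain y where y: "y \<in> K (head G e)" "dist z y \<le> \<rho> ^ n * D"
        using Suc.IH[OF head_out_arcs[OF e] z(1)] by blast
      have "y \<in> X (head G e)" using is_attractorD(3)[OF K head_out_arcs[OF e]] y(1) by blast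
      moreover have "z \<in> X (head G e)"
        using approximant_subset[OF head_out_arcs[OF e]] z(1) by blast
      ultimately have "dist x (S e y) = r e * dist z y"
        using e z(2) by (simp add: map_similarity)
      also have "\<dots> \<le> \<rho> * (\<rho> ^ n * D)"
        using y(2) \<rho> e ratio_pos[of e] D by (intro mult_mono) auto
      finally have "dist x (S e y) \<le> \<rho> ^ Suc n * D" by (simp add: mult.assoc)
      then show ?thesis using Ki e y(1) by blast
    qed
  qed
  show "(\<Inter>n. approximant n i) \<subseteq> K i"
  proof
    fix x assume x: "x \<in> (\<Inter>n. approximant n i)"
    have lim: "(\<lambda>n. \<rho> ^ n * D) \<longlonglongrightarrow> 0"
      using \<rho> by (intro tendsto_mult_left_zero LIMSEQ_power_zero) auto
    have "x \<in> closure (K i)"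
      unfolding closure_approachable
    proof (intro allI impI)
      fix \<epsilon> :: real assume "0 < \<epsilon>"
      then have "\<forall>\<^sub>F n in sequentially. \<rho> ^ n * D < \<epsilon>"
        using order_tendstoD(2)[OF lim] by blast
      then obtain n where n: "\<rho> ^ n * D < \<epsilon>" by (auto simp: eventually_sequentially)
      obtain y where "y \<in> K i" "dist x y \<le> \<rho> ^ n * D" using near[OF i] x by blast
      then show "\<exists>y\<in>K i. dist y x < \<epsilon>" using n by (auto simp: dist_commute intro!: bexI[of _ y])
    qed
    moreover have "closed (K i)" using is_attractorD(2)[OF K i] by (rule compact_imp_closed)
    ultimately show "x \<in> K i" by simp
  qed
qed

lemma is_attractor_inhom_attractor:
  assumes "mw_strongly_connected G"
  shows "is_attractor (inhom_attractor G X S C)"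
proof -
  \<comment> \<open>Cut to \<open>undefined\<close> off the vertex set, as
    \<open>extensional\<close> demands of the family described by
    \<open>inhom_attractor\<close>.\<close>
  let ?L = "restrict (\<lambda>i. \<Inter>n. approximant n i) (verts G)"
  have heads: "(\<Union>e\<in>out_arcs G i. S e ` ?L (head G e))
      = (\<Union>e\<in>out_arcs G i. S e ` (\<Inter>n. approximant n (head G e)))" for i
    by (intro SUP_cong) auto
  have L: "is_attractor ?L"
    unfolding is_attractor_def
  proof
    fix i assume i: "i \<in> verts G"
    have eq: "?L i = (\<Inter>n. approximant n i)" using i by simp
    show "?L i \<noteq> {} \<and> compact (?L i) \<and> ?L i \<subseteq> X i \<and>
        ?L i = C i \<union> (\<Union>e\<in>out_arcs G i. S e ` ?L (head G e))"
      unfolding eq heads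
      by (intro conjI is_attractorD[OF is_attractor_Inter_approximant[OF assms] i])
  qed
  have "\<exists>!K. K \<in> extensional (verts G) \<and> is_attractor K"
  proof (rule ex1I[of _ ?L])
    fix K assume K: "K \<in> extensional (verts G) \<and> is_attractor K"
    then show "K = ?L"
      by (intro extensionalityI[of _ "verts G"]) (auto simp: is_attractor_unique)
  qed (use L in auto)
  moreover have "inhom_attractor G X S C = (THE K. K \<in> extensional (verts G) \<and> is_attractor K)"
    unfolding inhom_attractor_def is_attractor_def ..
  ultimately show ?thesis using theI'[of "\<lambda>K. K \<in> extensional (verts G) \<and> is_attractor K"]
    by (simp only:)
qed

lemma path_map_condensation_subset:
  assumes K: "is_attractor K"
  shows "awalk i p j \<Longrightarrow> path_map p ` C j \<subseteq> K i"
proof (induction p arbitrary: i)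
  case Nil
  then have "i = j" "i \<in> verts G" by (auto simp: awalk_Nil_iff)
  then show ?case using is_attractorD(4)[OF K \<open>i \<in> verts G\<close>] by auto
next
  case (Cons e p)
  then have e: "e \<in> out_arcs G i" and p: "path_map p ` C j \<subseteq> K (head G e)"
    by (auto simp: awalk_Cons_iff)
  then have "i \<in> verts G" by auto
  then have "K i = C i \<union> (\<Union>e\<in>out_arcs G i. S e ` K (head G e))"
    by (rule is_attractorD(4)[OF K])
  then have "S e ` K (head G e) \<subseteq> K i" using e by blast
  then show ?case using p by auto
qed

end

context mauldin_williams_graph
begin

lemma attractor_path:
  assumes sc: "mw_strongly_connected G"
  shows "i \<in> verts G \<Longrightarrow> x \<in> attractor G X S i \<Longrightarrow>
    \<exists>p j. length p = n \<and> awalk i p j \<and> x \<in> path_map p ` X j"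
proof (induction n arbitrary: i x)
  \<comment> \<open>The homogeneous attractor is the case of empty condensation sets, so the results
    above apply to it.\<close>
  interpret I: inhom_mauldin_williams_graph G X S r "\<lambda>_. {}"
    by unfold_locales auto
  have K: "I.is_attractor (attractor G X S)"
    using I.is_attractor_inhom_attractor[OF sc] by (simp add: inhom_attractor_def attractor_def)
  {
    case 0
    then show ?case using I.is_attractorD(3)[OF K 0(1)] by (auto simp: awalk_Nil_iff)
  next
    case (Suc n)
    have "attractor G X S i = (\<Union>e\<in>out_arcs G i. S e ` attractor G X S (head G e))"
      using I.is_attractorD(4)[OF K Suc.prems(1)] by simp
    then obtain e y where e: "e \<in> out_arcs G i" "y \<in> attractor G X S (head G e)" "x = S e y"
      using Suc.prems(2) by blast
    obtain p j where "length p = n" "awalk (head G e) p j" "y \<in> path_map p ` X j"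
      using Suc.IH[OF I.head_out_arcs[OF e(1)] e(2)] by blast
    then have "length (e # p) = Suc n \<and> awalk i (e # p) j \<and> x \<in> path_map (e # p) ` X j"
      using e by (auto simp: awalk_Cons_iff)
    then show ?case by blast
  }
qed

end

section \<open>Covering numbers\<close>

lemma covering_number_le:
  "finite F \<Longrightarrow> A \<subseteq> (\<Union>x\<in>F. cball x \<delta>) \<Longrightarrow> covering_number \<delta> A \<le> card F"
  unfolding covering_number_def by (rule Least_le) blast

text \<open>Total boundedness provides some finite cover, so the minimum in
  \<open>covering_number\<close> is attained.\<close>

lemma covering_number_cover:
  assumes "compact A" "0 < \<delta>"
  obtains F where "finite F" "card F = covering_number \<delta> A" "A \<subseteq> (\<Union>x\<in>F. cball x \<delta>)"
proof -
  have "\<exists>F. finite F \<and> A \<subseteq> (\<Union>x\<in>F. ball x \<delta>)"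
    using assms unfolding compact_eq_totally_bounded by simp
  then obtain F where "finite F" "A \<subseteq> (\<Union>x\<in>F. ball x \<delta>)" by blast
  moreover have "(\<Union>x\<in>F. ball x \<delta>) \<subseteq> (\<Union>x\<in>F. cball x \<delta>)"
    by (intro UN_mono ball_subset_cball order.refl)
  ultimately have "\<exists>n F. finite F \<and> card F = n \<and> A \<subseteq> (\<Union>x\<in>F. cball x \<delta>)" by blast
  then have "\<exists>F. finite F \<and> card F = covering_number \<delta> A \<and> A \<subseteq> (\<Union>x\<in>F. cball x \<delta>)"
    unfolding covering_number_def by (rule LeastI_ex)
  then show ?thesis using that by blast
qed

lemma covering_number_antimono:
  assumes "compact A" "0 < \<delta>" "\<delta> \<le> \<delta>'"
  shows "covering_number \<delta>' A \<le> covering_number \<delta> A"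
proof -
  obtain F where F: "finite F" "card F = covering_number \<delta> A" "A \<subseteq> (\<Union>x\<in>F. cball x \<delta>)"
    by (rule covering_number_cover[OF assms(1,2)])
  have "(\<Union>x\<in>F. cball x \<delta>) \<subseteq> (\<Union>x\<in>F. cball x \<delta>')"
    using assms(3) by (intro UN_mono subset_cball order.refl)
  then have "A \<subseteq> (\<Union>x\<in>F. cball x \<delta>')" using F(3) by (rule order.trans[rotated])
  then show ?thesis using covering_number_le F by metis
qed

text \<open>The centres of a cover of the image need not lie in the domain of an inverse similarity, so
  they are first moved into the image, at the price of doubling the radius.\<close>

lemma covering_number_similarity:
  fixes f :: "'a::euclidean_space \<Rightarrow> 'b::euclidean_space"
  assumes sim: "\<And>x y. x \<in> A \<Longrightarrow> y \<in> A \<Longrightarrow> dist (f x) (f y) = c * dist x y"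
    and "0 < c" "0 < \<delta>" "compact (f ` A)"
  shows "covering_number (2 * \<delta> / c) A \<le> covering_number \<delta> (f ` A)"
proof -
  obtain F where F: "finite F" "card F = covering_number \<delta> (f ` A)" "f ` A \<subseteq> (\<Union>x\<in>F. cball x \<delta>)"
    by (rule covering_number_cover[OF assms(4,3)])
  \<comment> \<open>Only centres within \<open>\<delta>\<close> of the image have a nearby image
    point to which they can be moved.\<close>
  define F' where "F' = {x \<in> F. \<exists>a\<in>A. dist x (f a) \<le> \<delta>}"
  have "\<forall>x\<in>F'. \<exists>a\<in>A. dist x (f a) \<le> \<delta>" by (simp add: F'_def)
  then obtain g where g: "\<And>x. x \<in> F' \<Longrightarrow> g x \<in> A \<and> dist x (f (g x)) \<le> \<delta>" by metis
  have "A \<subseteq> (\<Union>y\<in>g ` F'. cball y (2 * \<delta> / c))"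
  proof
    fix a assume a: "a \<in> A"
    then obtain x where x: "x \<in> F" "dist x (f a) \<le> \<delta>" using F(3) by fastforce
    then have x': "x \<in> F'" using a by (auto simp: F'_def)
    have "c * dist (g x) a = dist (f (g x)) (f a)" using sim g[OF x'] a by simp
    also have "\<dots> \<le> 2 * \<delta>"
      using dist_triangle3[of "f (g x)" "f a" x] x(2) g[OF x'] by linarith
    finally have "dist (g x) a \<le> 2 * \<delta> / c" using \<open>0 < c\<close> by (simp add: field_simps)
    then show "a \<in> (\<Union>y\<in>g ` F'. cball y (2 * \<delta> / c))" using x' by auto
  qed
  then have "covering_number (2 * \<delta> / c) A \<le> card (g ` F')"
    using F(1) by (intro covering_number_le) (auto simp: F'_def)
  also have "\<dots> \<le> card F'" using F(1) by (intro card_image_le) (simp add: F'_def)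
  also have "\<dots> \<le> card F" using F(1) by (intro card_mono) (auto simp: F'_def)
  finally show ?thesis using F(2) by simp
qed

text \<open>Double counting. The balls of an optimal cover of \<open>K\<close> that meet
  \<open>B p\<close> cover \<open>B p\<close>, and each ball is charged by at most \<open>M\<close>
  of the pieces.\<close>

lemma sum_covering_number_le:
  assumes "finite Q" "compact K" "0 < \<delta>"
    and sub: "\<And>p. p \<in> Q \<Longrightarrow> B p \<subseteq> K"
    and overlap: "\<And>x. card {p \<in> Q. cball x \<delta> \<inter> B p \<noteq> {}} \<le> M"
  shows "(\<Sum>p\<in>Q. covering_number \<delta> (B p)) \<le> M * covering_number \<delta> K"
proof -
  obtain F where F: "finite F" "card F = covering_number \<delta> K" "K \<subseteq> (\<Union>x\<in>F. cball x \<delta>)"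
    by (rule covering_number_cover[OF assms(2,3)])
  have "covering_number \<delta> (B p) \<le> card {x \<in> F. cball x \<delta> \<inter> B p \<noteq> {}}" if "p \<in> Q" for p
  proof (rule covering_number_le)
    show "B p \<subseteq> (\<Union>x\<in>{x \<in> F. cball x \<delta> \<inter> B p \<noteq> {}}. cball x \<delta>)"
      using F(3) sub[OF that] by blast
  qed (use F(1) in simp)
  then have "(\<Sum>p\<in>Q. covering_number \<delta> (B p)) \<le> (\<Sum>p\<in>Q. card {x \<in> F. cball x \<delta> \<inter> B p \<noteq> {}})"
    by (rule sum_mono)
  also have "\<dots> = (\<Sum>x\<in>F. card {p \<in> Q. cball x \<delta> \<inter> B p \<noteq> {}})"
    unfolding card_eq_sum using F(1) assms(1) by (intro sum.swap_restrict)
  also have "\<dots> \<le> (\<Sum>x\<in>F. M)" by (intro sum_mono overlap)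
  also have "\<dots> = M * covering_number \<delta> K" using F(2) by simp
  finally show ?thesis .
qed

text \<open>A similarity between spaces of equal dimension maps balls onto balls: the image is open by
  invariance of domain and relatively closed, and balls are connected.\<close>

lemma ball_subset_similarity_image:
  fixes f :: "'a::euclidean_space \<Rightarrow> 'a"
  assumes sim: "\<And>x y. x \<in> ball z \<eta> \<Longrightarrow> y \<in> ball z \<eta> \<Longrightarrow> dist (f x) (f y) = c * dist x y" and "0 < c"
  shows "ball (f z) (c * \<eta>) \<subseteq> f ` ball z \<eta>"
proof
  fix y assume y: "y \<in> ball (f z) (c * \<eta>)"
  then have "0 < c * \<eta>" by (metis ball_eq_empty empty_iff not_le)
  then have "0 < \<eta>" using \<open>0 < c\<close> by (simp add: zero_less_mult_iff)
  define q where "q = dist (f z) y / c"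
  \<comment> \<open>The radius \<open>d\<close> lies strictly between \<open>q\<close> and
    \<open>\<eta>\<close>: the closed ball of radius \<open>d\<close> stays inside the domain, so
    its image is compact, while \<open>y\<close> is still within \<open>c * d\<close> of
    \<open>f z\<close>.\<close>
  define d where "d = (q + \<eta>) / 2"
  have "q < \<eta>" using y \<open>0 < c\<close> by (simp add: q_def divide_less_eq mult.commute)
  then have "q < d" "d < \<eta>" by (auto simp: d_def)
  have "0 \<le> q" using \<open>0 < c\<close> by (simp add: q_def)
  then have "0 < d" using \<open>q < d\<close> by simp
  have "dist (f z) y < c * d"
    using \<open>q < d\<close> \<open>0 < c\<close> by (simp add: q_def divide_less_eq mult.commute)
  note d = this \<open>d < \<eta>\<close>
  have z: "z \<in> ball z \<eta>" using \<open>0 < \<eta>\<close> by simp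
  have cont: "continuous_on (ball z \<eta>) f"
  proof (rule lipschitz_on_continuous_on)
    show "c-lipschitz_on (ball z \<eta>) f" using sim \<open>0 < c\<close> by (auto simp: lipschitz_on_def)
  qed
  have "inj_on f (ball z \<eta>)"
    using sim \<open>0 < c\<close> by (intro inj_onI) (metis dist_eq_0_iff less_irrefl mult_eq_0_iff)
  then have "open (f ` ball z \<eta>)" using cont by (intro invariance_of_domain) auto
  have "compact (f ` cball z d)"
    using d by (intro compact_continuous_image continuous_on_subset[OF cont]) auto
  then have "closed (f ` cball z d)" by (rule compact_imp_closed)
  \<comment> \<open>Within distance \<open>c * d\<close> of \<open>f z\<close> the images of the
    open ball and of the smaller closed ball agree, so this common trace is both open and
    closed.\<close>
  have eq: "ball (f z) (c * d) \<inter> f ` cball z d = ball (f z) (c * d) \<inter> f ` ball z \<eta>"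
  proof (intro equalityI subsetI)
    fix x assume "x \<in> ball (f z) (c * d) \<inter> f ` ball z \<eta>"
    then obtain x' where x': "x' \<in> ball z \<eta>" "x = f x'" "dist (f z) (f x') < c * d" by auto
    then have "dist z x' < d" using sim[OF z x'(1)] \<open>0 < c\<close> by simp
    then show "x \<in> ball (f z) (c * d) \<inter> f ` cball z d" using x' by auto
  qed (use d in auto)
  have "ball (f z) (c * d) \<inter> f ` ball z \<eta> = {} \<or>
      ball (f z) (c * d) \<inter> f ` ball z \<eta> = ball (f z) (c * d)"
  proof (rule connected_clopen[THEN iffD1, rule_format, OF connected_ball])
    show "openin (top_of_set (ball (f z) (c * d))) (ball (f z) (c * d) \<inter> f ` ball z \<eta>) \<and>
        closedin (top_of_set (ball (f z) (c * d))) (ball (f z) (c * d) \<inter> f ` ball z \<eta>)"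
      using openin_open_Int[OF \<open>open (f ` ball z \<eta>)\<close>, of "ball (f z) (c * d)"]
        closedin_closed_Int[OF \<open>closed (f ` cball z d)\<close>, of "ball (f z) (c * d)"]
      unfolding eq by blast
  qed
  moreover have "f z \<in> ball (f z) (c * d) \<inter> f ` ball z \<eta>" using z \<open>0 < d\<close> \<open>0 < c\<close> by auto
  ultimately have "ball (f z) (c * d) \<subseteq> f ` ball z \<eta>" by blast
  then show "y \<in> f ` ball z \<eta>" using d(1) by auto
qed

section \<open>Separation of the condensation pieces\<close>

text \<open>The strong condensation open set condition with its witness \<open>U\<close> fixed, and
  with the unions over outgoing edges restated edge by edge.\<close>

locale scosc = inhom_mauldin_williams_graph G X S r C
  for G :: "('v, 'e) pre_digraph" (structure)
    and X :: "'v \<Rightarrow> 'a::euclidean_space set"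
    and S :: "'e \<Rightarrow> 'a \<Rightarrow> 'a"
    and r :: "'e \<Rightarrow> real"
    and C :: "'v \<Rightarrow> 'a set" +
  fixes U :: "'v \<Rightarrow> 'a set"
  assumes sc: "mw_strongly_connected G"
    and U_open: "i \<in> verts G \<Longrightarrow> open (U i)"
    and U_subset: "i \<in> verts G \<Longrightarrow> U i \<subseteq> X i"
    and U_map: "e \<in> arcs G \<Longrightarrow> S e ` U (head G e) \<subseteq> U (tail G e)"
    and U_disjoint: "e \<in> arcs G \<Longrightarrow> e' \<in> arcs G \<Longrightarrow> tail G e = tail G e' \<Longrightarrow> e \<noteq> e' \<Longrightarrow>
      S e ` U (head G e) \<inter> S e' ` U (head G e') = {}"
    and U_attractor: "i \<in> verts G \<Longrightarrow> U i \<inter> attractor G X S i \<noteq> {}"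
    and C_closure: "i \<in> verts G \<Longrightarrow> C i \<subseteq> closure (U i)"
    and C_avoids: "e \<in> arcs G \<Longrightarrow> C (tail G e) \<inter> S e ` U (head G e) = {}"
begin

lemma path_map_Cons_image: "path_map (e # p) ` A = S e ` path_map p ` A"
  by (simp add: image_comp)

lemma path_map_U: "awalk i p j \<Longrightarrow> path_map p ` U j \<subseteq> U i"
proof (induction p arbitrary: i)
  case (Cons e p)
  then have e: "e \<in> arcs G" "i = tail G e" and "path_map p ` U j \<subseteq> U (head G e)"
    by (auto simp: awalk_Cons_iff)
  then have "path_map (e # p) ` U j \<subseteq> S e ` U (head G e)"
    unfolding path_map_Cons_image by (intro image_mono)
  then show ?case using U_map[OF e(1)] e(2) by blast
qed (auto simp: awalk_Nil_iff)

lemma closure_U_subset: "i \<in> verts G \<Longrightarrow> closure (U i) \<subseteq> X i"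
  using U_subset space_compact by (intro closure_minimal compact_imp_closed) auto

lemma arc_image_closure:
  assumes "e \<in> arcs G"
  shows "S e ` closure (U (head G e)) \<subseteq> closure (S e ` U (head G e))"
  using assms
  by (intro image_closure_subset closure_subset closed_closure
      continuous_on_subset[OF continuous_on_arc closure_U_subset]) auto

lemma open_arc_image:
  assumes "e \<in> arcs G"
  shows "open (S e ` U (head G e))"
proof -
  have h: "head G e \<in> verts G" using assms by auto
  then show ?thesis
    using continuous_on_subset[OF continuous_on_arc[OF assms] U_subset[OF h]]
      inj_on_subset[OF inj_on_arc[OF assms] U_subset[OF h]] U_open[OF h]
    by (intro invariance_of_domain)
qed

lemma path_map_condensation_closure: "awalk i p j \<Longrightarrow> path_map p ` C j \<subseteq> closure (U i)"
proof (induction p arbitrary: i)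
  case Nil
  then show ?case using C_closure by (auto simp: awalk_Nil_iff)
next
  case (Cons e p)
  then have e: "e \<in> arcs G" "i = tail G e" and "awalk (head G e) p j" by (auto simp: awalk_Cons_iff)
  then have "path_map (e # p) ` C j \<subseteq> S e ` closure (U (head G e))"
    unfolding path_map_Cons_image by (intro image_mono Cons.IH)
  also have "\<dots> \<subseteq> closure (S e ` U (head G e))" by (rule arc_image_closure[OF e(1)])
  also have "\<dots> \<subseteq> closure (U i)" using U_map[OF e(1)] e(2) by (simp add: closure_mono)
  finally show ?case .
qed

text \<open>Common initial edges are stripped off by injectivity. If \<open>p\<close> runs out
  first, the condensation set avoids the image of \<open>U\<close> under the next edge of
  \<open>q\<close>. If the next edges differ, the piece lies in the closure of one image of
  \<open>U\<close>, and the other image, being open and disjoint from the first, misses that closure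
  too.\<close>

lemma path_condensation_disjoint:
  "awalk i p j \<Longrightarrow> awalk i q k \<Longrightarrow> \<not> prefix q p \<Longrightarrow> path_map p ` C j \<inter> path_map q ` U k = {}"
proof (induction q arbitrary: i p)
  case (Cons e q)
  then have e: "e \<in> arcs G" "tail G e = i" and q: "awalk (head G e) q k"
    by (auto simp: awalk_Cons_iff)
  have sub: "path_map (e # q) ` U k \<subseteq> S e ` U (head G e)"
    unfolding path_map_Cons_image by (intro image_mono path_map_U[OF q])
  show ?case
  proof (cases p)
    case Nil
    then have "j = i" using Cons.prems(1) by (simp add: awalk_Nil_iff)
    then have "path_map p ` C j = C (tail G e)" using Nil e(2) by simp
    then show ?thesis using C_avoids[OF e(1)] sub by blast
  next
    case p: (Cons e' p')
    then have e': "e' \<in> arcs G" "tail G e' = i" and p': "awalk (head G e') p' j"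
      using Cons.prems(1) by (auto simp: awalk_Cons_iff)
    show ?thesis
    proof (cases "e' = e")
      case True
      have disj: "path_map p' ` C j \<inter> path_map q ` U k = {}"
        using Cons.prems p' q True p by (intro Cons.IH) auto
      have "j \<in> verts G" "k \<in> verts G" using p' q by auto
      then have "path_map p' ` C j \<subseteq> X (head G e)" "path_map q ` U k \<subseteq> X (head G e)"
        using path_map_in[OF p'] path_map_in[OF q] condensation_subset U_subset True by fastforce+
      then have "S e ` (path_map p' ` C j) \<inter> S e ` (path_map q ` U k) = {}"
        using inj_on_image_Int[OF inj_on_arc[OF e(1)], of "path_map p' ` C j" "path_map q ` U k"] disj
        by simp
      then show ?thesis unfolding p True path_map_Cons_image .
    next
      case False
      have "path_map p ` C j \<subseteq> S e' ` closure (U (head G e'))"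
        unfolding p path_map_Cons_image by (intro image_mono path_map_condensation_closure[OF p'])
      also have "\<dots> \<subseteq> closure (S e' ` U (head G e'))" by (rule arc_image_closure[OF e'(1)])
      finally have "path_map p ` C j \<subseteq> closure (S e' ` U (head G e'))" .
      moreover have "S e ` U (head G e) \<inter> closure (S e' ` U (head G e')) = {}"
        using U_disjoint[OF e(1) e'(1)] e e' False open_Int_closure_eq_empty[OF open_arc_image[OF e(1)]]
        by auto
      ultimately show ?thesis using sub by blast
    qed
  qed
qed simp

text \<open>Follow the coding of an attractor point \<open>x\<close> of \<open>U i\<close> until the
  image of the space has diameter below \<open>\<epsilon> / 2\<close>, then continue to
  \<open>j\<close> by strong connectivity. The resulting image stays within
  \<open>\<epsilon> / 2\<close> of \<open>x\<close>, which leaves room for balls of that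
  radius.\<close>

lemma deep_path:
  assumes i: "i \<in> verts G" and j: "j \<in> verts G"
  obtains w \<eta> where "awalk i w j" "0 < \<eta>" "\<And>x. x \<in> X j \<Longrightarrow> ball (path_map w x) \<eta> \<subseteq> U i"
proof -
  obtain x where x: "x \<in> U i" "x \<in> attractor G X S i" using U_attractor[OF i] by blast
  obtain \<epsilon> where \<epsilon>: "0 < \<epsilon>" "ball x \<epsilon> \<subseteq> U i" using U_open[OF i] x(1) open_contains_ball by blast
  obtain D where D: "0 < D" "\<And>i x y. i \<in> verts G \<Longrightarrow> x \<in> X i \<Longrightarrow> y \<in> X i \<Longrightarrow> dist x y \<le> D"
    using diameter_bound by blast
  obtain m \<rho> where \<rho>: "0 < m" "m \<le> \<rho>" "\<rho> < 1" "\<And>e. e \<in> arcs G \<Longrightarrow> m \<le> r e \<and> r e \<le> \<rho>"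
    using ratio_bounds by blast
  have lim: "(\<lambda>n. \<rho> ^ n * D) \<longlonglongrightarrow> 0"
    using \<rho> by (intro tendsto_mult_left_zero LIMSEQ_power_zero) auto
  have "\<forall>\<^sub>F n in sequentially. \<rho> ^ n * D < \<epsilon> / 2"
    using order_tendstoD(2)[OF lim, of "\<epsilon> / 2"] \<epsilon>(1) by simp
  then obtain n where n: "\<rho> ^ n * D < \<epsilon> / 2" by (auto simp: eventually_sequentially)
  obtain p k where p: "length p = n" "awalk i p k" "x \<in> path_map p ` X k"
    using attractor_path[OF sc i x(2)] by blast
  then have k: "k \<in> verts G" by auto
  obtain y where y: "y \<in> X k" "x = path_map p y" using p(3) by blast
  obtain q where q: "awalk k q j" using path_exists[OF sc k j] by blast
  have pq: "awalk i (p @ q) j" using p(2) q by (rule awalk_appendI)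
  have "ball (path_map (p @ q) z) (\<epsilon> / 2) \<subseteq> U i" if z: "z \<in> X j" for z
  proof -
    have zq: "path_map q z \<in> X k" using path_map_in[OF q z] .
    have "dist x (path_map (p @ q) z) = path_ratio p * dist y (path_map q z)"
      using dist_path_map[OF p(2) y(1) zq] y(2) by (simp add: path_map_append)
    also have "\<dots> \<le> \<rho> ^ n * D"
      using path_ratio_le_power[OF _ p(2), of \<rho>] \<rho> p(1) D(2)[OF k y(1) zq] path_ratio_pos[OF p(2)]
      by (intro mult_mono) auto
    finally have "dist x (path_map (p @ q) z) < \<epsilon> / 2" using n by simp
    then have "ball (path_map (p @ q) z) (\<epsilon> / 2) \<subseteq> ball x \<epsilon>"
      by (simp add: ball_subset_ball_iff dist_commute)
    then show ?thesis using \<epsilon>(2) by blast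
  qed
  then show ?thesis using that[of "p @ q" "\<epsilon> / 2"] pq \<epsilon>(1) by simp
qed

lemma uniform_deep_paths:
  assumes j: "j \<in> verts G"
  obtains w \<eta> where "0 < \<eta>" "\<And>i. i \<in> verts G \<Longrightarrow> awalk i (w i) j"
    "\<And>i x. i \<in> verts G \<Longrightarrow> x \<in> X j \<Longrightarrow> ball (path_map (w i) x) \<eta> \<subseteq> U i"
proof -
  have "\<forall>i\<in>verts G. \<exists>w \<eta>. awalk i w j \<and> 0 < \<eta> \<and> (\<forall>x\<in>X j. ball (path_map w x) \<eta> \<subseteq> U i)"
    using deep_path[OF _ j] by metis
  then obtain w \<eta> where w: "\<And>i. i \<in> verts G \<Longrightarrow> awalk i (w i) j \<and> 0 < \<eta> i"
    "\<And>i x. i \<in> verts G \<Longrightarrow> x \<in> X j \<Longrightarrow> ball (path_map (w i) x) (\<eta> i) \<subseteq> U i"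
    by metis
  define \<eta>0 where "\<eta>0 = Min (\<eta> ` verts G)"
  have "\<eta>0 \<in> \<eta> ` verts G" unfolding \<eta>0_def using j by (intro Min_in) auto
  then have "0 < \<eta>0" using w by auto
  moreover have "ball (path_map (w i) x) \<eta>0 \<subseteq> U i" if "i \<in> verts G" "x \<in> X j" for i x
  proof -
    have "\<eta>0 \<le> \<eta> i" unfolding \<eta>0_def using that(1) by (intro Min_le) auto
    then show ?thesis using w(2)[OF that] subset_ball by blast
  qed
  ultimately show ?thesis using that[of \<eta>0 w] w(1) by blast
qed

section \<open>Overlap of the deep pieces\<close>

context
  fixes j :: 'v and w :: "'v \<Rightarrow> 'e list" and \<eta> :: real and L :: nat
  assumes j: "j \<in> verts G" and \<eta>: "0 < \<eta>"
    and w: "\<And>i. i \<in> verts G \<Longrightarrow> awalk i (w i) j"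
    and deep: "\<And>i x. i \<in> verts G \<Longrightarrow> x \<in> X j \<Longrightarrow> ball (path_map (w i) x) \<eta> \<subseteq> U i"
    and L: "\<And>i. i \<in> verts G \<Longrightarrow> length (w i) \<le> L"
begin

text \<open>The piece attached to \<open>p\<close> in the overview. Here \<open>awlast i p\<close>
  is the vertex where \<open>p\<close> ends, so the path appended depends on that vertex
  alone.\<close>

definition deep_piece :: "'v \<Rightarrow> 'e list \<Rightarrow> 'a set" where
  "deep_piece i p = path_map (p @ w (awlast i p)) ` C j"

text \<open>The map of \<open>q\<close> sends the ball of radius \<open>\<eta>\<close> inside
  \<open>U l\<close> onto a set containing the ball of radius \<open>path_ratio q * \<eta>\<close>
  around \<open>z\<close>. That ball therefore lies in the image of \<open>U l\<close>, which the
  piece of \<open>p\<close> avoids.\<close>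

lemma deep_pieces_separated:
  assumes p: "awalk i p k" and q: "awalk i q l" and np: "\<not> prefix q (p @ w k)"
    and y: "y \<in> deep_piece i p" and z: "z \<in> deep_piece i q"
  shows "path_ratio q * \<eta> \<le> dist y z"
proof -
  have kl: "k \<in> verts G" "l \<in> verts G" using p q by auto
  obtain c where c: "c \<in> C j" "z = path_map q (path_map (w l) c)"
    using z q by (auto simp: deep_piece_def path_map_append)
  then have cX: "c \<in> X j" using condensation_subset[OF j] by blast
  let ?z = "path_map (w l) c"
  have sub: "ball ?z \<eta> \<subseteq> U l" by (rule deep[OF kl(2) cX])
  then have subX: "ball ?z \<eta> \<subseteq> X l" using U_subset[OF kl(2)] by blast
  have "ball z (path_ratio q * \<eta>) \<subseteq> path_map q ` ball ?z \<eta>"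
    unfolding c(2)
    by (intro ball_subset_similarity_image dist_path_map[OF q] subsetD[OF subX] path_ratio_pos[OF q])
  also have "\<dots> \<subseteq> path_map q ` U l" using sub by (rule image_mono)
  finally have "ball z (path_ratio q * \<eta>) \<subseteq> path_map q ` U l" .
  moreover have "y \<notin> path_map q ` U l"
    using path_condensation_disjoint[OF awalk_appendI[OF p w[OF kl(1)]] q np] y p
    by (auto simp: deep_piece_def)
  ultimately have "y \<notin> ball z (path_ratio q * \<eta>)" by blast
  then show ?thesis by (simp add: dist_commute)
qed

text \<open>Two pieces meeting one ball contain points at distance at most
  \<open>2 * \<delta>\<close>, too close for separation, so each path is a prefix of the other with
  its attached path. Lengths then determine the paths and lie in a window of \<open>L + 1\<close>
  values.\<close>

lemma deep_pieces_overlap: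
  assumes Q: "\<And>p. p \<in> Q \<Longrightarrow> \<exists>k. awalk i p k \<and> 2 * \<delta> < path_ratio p * \<eta>"
  shows "card {p \<in> Q. cball x \<delta> \<inter> deep_piece i p \<noteq> {}} \<le> Suc L"
proof -
  define T where "T = {p \<in> Q. cball x \<delta> \<inter> deep_piece i p \<noteq> {}}"
  have comparable: "\<exists>u. length u \<le> L \<and> prefix q (p @ u)" if pq: "p \<in> T" "q \<in> T" for p q
  proof -
    obtain k l where k: "awalk i p k" and l: "awalk i q l" "2 * \<delta> < path_ratio q * \<eta>"
      using Q pq unfolding T_def by blast
    obtain y z where y: "y \<in> deep_piece i p" "dist x y \<le> \<delta>" and z: "z \<in> deep_piece i q" "dist x z \<le> \<delta>"
      using pq by (auto simp: T_def)
    have "dist y z \<le> 2 * \<delta>" using dist_triangle3[of y z x] y(2) z(2) by linarith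
    then have "prefix q (p @ w k)"
      using deep_pieces_separated[OF k l(1) _ y(1) z(1)] l(2) by fastforce
    moreover have "length (w k) \<le> L" using k by (intro L) auto
    ultimately show ?thesis by blast
  qed
  have len: "length q \<le> length p + L" if "p \<in> T" "q \<in> T" for p q
    using comparable[OF that] prefix_length_le by fastforce
  have inj: "inj_on length T"
  proof (rule inj_onI)
    fix p q assume "p \<in> T" "q \<in> T" and eq: "length p = length q"
    then obtain u where "prefix q (p @ u)" using comparable by blast
    then obtain v where "p @ u = q @ v" by (auto simp: prefix_def)
    then show "p = q" using eq by simp
  qed
  show ?thesis
  proof (cases "T = {}")
    case False
    then obtain p0 where "p0 \<in> T" by blast
    then obtain p where p: "p \<in> T" "\<And>q. q \<in> T \<Longrightarrow> length p \<le> length q"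
      using ex_has_least_nat[of "\<lambda>q. q \<in> T" p0 length] by metis
    then have "length ` T \<subseteq> {length p..length p + L}" using len[OF p(1)] by auto
    then have "card (length ` T) \<le> card {length p..length p + L}" by (intro card_mono) auto
    then show ?thesis using card_image[OF inj] by (simp add: T_def)
  qed (simp add: T_def[symmetric])
qed

lemma sum_covering_number_deep_pieces:
  assumes "finite Q" "i \<in> verts G" "0 < \<delta>"
    and Q: "\<And>p. p \<in> Q \<Longrightarrow> \<exists>k. awalk i p k \<and> 2 * \<delta> < path_ratio p * \<eta>"
  shows "(\<Sum>p\<in>Q. covering_number \<delta> (deep_piece i p))
    \<le> Suc L * covering_number \<delta> (inhom_attractor G X S C i)"
proof (rule sum_covering_number_le[OF assms(1) _ assms(3)])
  have K: "is_attractor (inhom_attractor G X S C)" by (rule is_attractor_inhom_attractor[OF sc])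
  then show "compact (inhom_attractor G X S C i)" using assms(2) by (rule is_attractorD(2))
  show "deep_piece i p \<subseteq> inhom_attractor G X S C i" if pQ: "p \<in> Q" for p
  proof -
    obtain k where k: "awalk i p k" using Q[OF pQ] by blast
    then have "awalk i (p @ w k) j" using w by (auto intro: awalk_appendI)
    then show ?thesis using path_map_condensation_subset[OF K] k by (simp add: deep_piece_def)
  qed
  show "card {p \<in> Q. cball x \<delta> \<inter> deep_piece i p \<noteq> {}} \<le> Suc L" for x
    by (rule deep_pieces_overlap[OF Q])
qed

lemma covering_number_deep_piece:
  assumes p: "awalk i p k" and "0 < \<delta>"
  shows "covering_number (2 * \<delta> / (path_ratio p * path_ratio (w k))) (C j)
    \<le> covering_number \<delta> (deep_piece i p)"
proof -
  have pw: "awalk i (p @ w k) j" using p w by (auto intro: awalk_appendI)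
  have "covering_number (2 * \<delta> / path_ratio (p @ w k)) (C j)
      \<le> covering_number \<delta> (path_map (p @ w k) ` C j)"
    using dist_path_map[OF pw] condensation_subset[OF j] condensation_compact[OF j]
      path_ratio_pos[OF pw] \<open>0 < \<delta>\<close> continuous_on_path_map[OF pw]
    by (intro covering_number_similarity compact_continuous_image) (auto intro: continuous_on_subset)
  then show ?thesis using p by (simp add: deep_piece_def path_ratio_append)
qed

end

end

section \<open>The renewal inequality\<close>

context mauldin_williams_graph
begin

text \<open>The cutoff is logarithmic so that removing a first edge \<open>e\<close> shifts
  \<open>T\<close> by \<open>ln (r e)\<close>. It keeps exactly those paths for which
  \<open>T + ln (path_ratio p)\<close> is nonnegative.\<close>

definition paths_upto :: "'v \<Rightarrow> real \<Rightarrow> 'e list set" where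
  "paths_upto i T = {p. \<exists>j. awalk i p j \<and> exp (- T) \<le> path_ratio p}"

lemma finite_paths_upto: "finite (paths_upto i T)"
proof -
  obtain m \<rho> where \<rho>: "0 < m" "m \<le> \<rho>" "\<rho> < 1" "\<And>e. e \<in> arcs G \<Longrightarrow> m \<le> r e \<and> r e \<le> \<rho>"
    using ratio_bounds by blast
  obtain n where n: "\<rho> ^ n < exp (- T)"
    using real_arch_pow_inv[of "exp (- T)" \<rho>] \<rho> by auto
  have "set p \<subseteq> arcs G \<and> length p \<le> n" if "p \<in> paths_upto i T" for p
  proof -
    obtain j where j: "awalk i p j" "exp (- T) \<le> path_ratio p"
      using \<open>p \<in> paths_upto i T\<close> by (auto simp: paths_upto_def)
    moreover have "path_ratio p \<le> \<rho> ^ length p"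
      by (rule path_ratio_le_power[OF _ j(1)]) (use \<rho>(4) in auto)
    ultimately have "\<rho> ^ n < \<rho> ^ length p" using n by linarith
    then have "length p < n" using \<rho> by (simp add: power_strict_decreasing_iff)
    then show ?thesis using j(1) by auto
  qed
  then have "paths_upto i T \<subseteq> {p. set p \<subseteq> arcs G \<and> length p \<le> n}" by blast
  then show ?thesis using finite_lists_length_le[OF finite_arcs] finite_subset by blast
qed

lemma paths_upto_Cons:
  assumes "e \<in> out_arcs G i"
  shows "e # p \<in> paths_upto i T \<longleftrightarrow> p \<in> paths_upto (head G e) (T + ln (r e))"
proof -
  have r: "0 < r e" using assms ratio_pos by simp
  have "exp (- (T + ln (r e))) = exp (- T) / r e" using r by (simp add: exp_diff exp_minus field_simps exp_add)
  then have "exp (- T) \<le> r e * q \<longleftrightarrow> exp (- (T + ln (r e))) \<le> q" for q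
    using r by (simp add: divide_le_eq mult.commute)
  then show ?thesis using assms by (auto simp: paths_upto_def awalk_Cons_iff)
qed

lemma paths_upto_decomp:
  assumes "i \<in> verts G" "0 \<le> T"
  shows "paths_upto i T
    = insert [] (\<Union>e\<in>out_arcs G i. (#) e ` paths_upto (head G e) (T + ln (r e)))" (is "?L = ?R")
proof (rule Set.set_eqI)
  fix p
  show "p \<in> ?L \<longleftrightarrow> p \<in> ?R"
  proof (cases p)
    case Nil
    then show ?thesis using assms by (auto simp: paths_upto_def awalk_Nil_iff)
  next
    case (Cons e q)
    show ?thesis
    proof (cases "e \<in> out_arcs G i")
      case True
      then show ?thesis unfolding Cons paths_upto_Cons[OF True] by auto
    next
      case False
      then have "e # q \<notin> ?L" by (auto simp: paths_upto_def awalk_Cons_iff)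
      then show ?thesis using Cons False by auto
    qed
  qed
qed

text \<open>The renewal equation: the empty path contributes \<open>\<phi> T\<close>, and the other
  paths are sorted by their first edge.\<close>

lemma sum_paths_upto_decomp:
  fixes \<phi> :: "real \<Rightarrow> real"
  assumes "i \<in> verts G" "0 \<le> T"
  shows "(\<Sum>p\<in>paths_upto i T. \<phi> (T + ln (path_ratio p))) = \<phi> T +
    (\<Sum>e\<in>out_arcs G i. \<Sum>p\<in>paths_upto (head G e) (T + ln (r e)). \<phi> (T + ln (r e) + ln (path_ratio p)))"
proof -
  let ?B = "\<lambda>e. (#) e ` paths_upto (head G e) (T + ln (r e))"
  have "(\<Sum>p\<in>paths_upto i T. \<phi> (T + ln (path_ratio p)))
      = \<phi> T + (\<Sum>p\<in>(\<Union>e\<in>out_arcs G i. ?B e). \<phi> (T + ln (path_ratio p)))"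
    unfolding paths_upto_decomp[OF assms]
    using finite_paths_upto finite_out_arcs[of i]
    by (subst sum.insert) (auto simp del: in_out_arcs_conv)
  also have "(\<Sum>p\<in>(\<Union>e\<in>out_arcs G i. ?B e). \<phi> (T + ln (path_ratio p)))
      = (\<Sum>e\<in>out_arcs G i. \<Sum>p\<in>?B e. \<phi> (T + ln (path_ratio p)))"
    using finite_paths_upto finite_out_arcs[of i] by (intro sum.UNION_disjoint) auto
  also have "\<dots> = (\<Sum>e\<in>out_arcs G i. \<Sum>p\<in>paths_upto (head G e) (T + ln (r e)).
      \<phi> (T + ln (r e) + ln (path_ratio p)))"
  proof (rule sum.cong[OF refl])
    fix e assume e: "e \<in> out_arcs G i"
    have "(\<Sum>p\<in>?B e. \<phi> (T + ln (path_ratio p)))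
        = (\<Sum>p\<in>paths_upto (head G e) (T + ln (r e)). \<phi> (T + ln (path_ratio (e # p))))"
      by (subst sum.reindex) auto
    also have "\<dots> = (\<Sum>p\<in>paths_upto (head G e) (T + ln (r e)). \<phi> (T + ln (r e) + ln (path_ratio p)))"
    proof (rule sum.cong[OF refl])
      fix p assume "p \<in> paths_upto (head G e) (T + ln (r e))"
      then obtain j where "awalk (head G e) p j" by (auto simp: paths_upto_def)
      then have "0 < path_ratio p" by (rule path_ratio_pos)
      then show "\<phi> (T + ln (path_ratio (e # p))) = \<phi> (T + ln (r e) + ln (path_ratio p))"
        using ratio_pos[of e] e by (simp add: ln_mult add.assoc)
    qed
    finally show "(\<Sum>p\<in>?B e. \<phi> (T + ln (path_ratio p)))
        = (\<Sum>p\<in>paths_upto (head G e) (T + ln (r e)). \<phi> (T + ln (r e) + ln (path_ratio p)))" .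
  qed
  finally show ?thesis .
qed

text \<open>The weights \<open>v\<close> turn \<open>T \<mapsto> e\<^sup>s\<^sup>T \<Phi> T\<close> into a subsolution of the renewal equation that
  the path sums satisfy.\<close>

lemma renewal_lower_bound:
  fixes \<phi> \<Phi> :: "real \<Rightarrow> real"
  assumes v: "\<And>i. i \<in> verts G \<Longrightarrow> 0 < v i"
    "\<And>i. i \<in> verts G \<Longrightarrow> v i \<le> (\<Sum>e\<in>out_arcs G i. r e powr s * v (head G e))"
    and \<phi>: "\<And>T. 0 \<le> \<phi> T"
    and \<Phi>: "\<And>T. 0 \<le> \<Phi> T" "\<And>T. T < 0 \<Longrightarrow> \<Phi> T = 0"
    and "0 < B"
    and step: "\<And>e T. e \<in> arcs G \<Longrightarrow> 0 \<le> T \<Longrightarrow> \<Phi> T \<le> \<Phi> (T + ln (r e)) + B * exp (- s * T) * \<phi> T"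
    and i: "i \<in> verts G"
  obtains c where "0 < c"
    "\<And>T. c * exp (s * T) * \<Phi> T \<le> (\<Sum>p\<in>paths_upto i T. \<phi> (T + ln (path_ratio p)))"
proof -
  define H where "H i T = (\<Sum>p\<in>paths_upto i T. \<phi> (T + ln (path_ratio p)))" for i T
  define Av where "Av i = (\<Sum>e\<in>out_arcs G i. r e powr s * v (head G e))" for i
  define V where "V = Max (insert 1 (Av ` verts G))"
  have V: "0 < V" "\<And>i. i \<in> verts G \<Longrightarrow> Av i \<le> V"
  proof -
    have "1 \<le> V" unfolding V_def by (intro Max_ge) auto
    then show "0 < V" by simp
    show "Av i \<le> V" if "i \<in> verts G" for i unfolding V_def using that by (intro Max_ge) auto
  qed
  \<comment> \<open>Chosen so that the error terms of one renewal step, summed over the outgoing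
    edges, amount to at most \<open>\<phi> T\<close>.\<close>
  define c where "c = 1 / (B * V)"
  have c: "0 < c" "c * B * V = 1" using \<open>0 < B\<close> V(1) by (auto simp: c_def)
  obtain m \<rho> where \<rho>: "0 < m" "m \<le> \<rho>" "\<rho> < 1" "\<And>e. e \<in> arcs G \<Longrightarrow> m \<le> r e \<and> r e \<le> \<rho>"
    using ratio_bounds by blast
  have \<rho>pos: "0 < \<rho>" using \<rho> by linarith
  have H_nonneg: "0 \<le> H i T" for i T unfolding H_def using \<phi> by (intro sum_nonneg) auto
  \<comment> \<open>Each edge lowers \<open>T\<close> by at least \<open>- ln \<rho>\<close>, so
    induction on \<open>n\<close> reaches negative arguments, where \<open>\<Phi>\<close>
    vanishes.\<close>
  have key: "c * v i * exp (s * T) * \<Phi> T \<le> H i T" if "i \<in> verts G" "T < real n * - ln \<rho>" for n i T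
    using that
  proof (induction n arbitrary: i T)
    case 0
    then show ?case using \<Phi>(2) H_nonneg by simp
  next
    case (Suc n)
    show ?case
    proof (cases "T < 0")
      case True
      then show ?thesis using \<Phi>(2) H_nonneg by simp
    next
      case False
      let ?h = "\<lambda>e. v (head G e)"
      have E: "e \<in> arcs G" "0 < r e" "r e \<le> \<rho>" "0 < ?h e" "head G e \<in> verts G"
        if "e \<in> out_arcs G i" for e
        using that \<rho>(4) ratio_pos v(1) by auto
      have powr_exp: "r e powr s * exp (s * T) = exp (s * (T + ln (r e)))" if "e \<in> out_arcs G i" for e
        using E(2)[OF that] by (simp add: powr_def distrib_left exp_add)
      have IH: "c * ?h e * exp (s * (T + ln (r e))) * \<Phi> (T + ln (r e)) \<le> H (head G e) (T + ln (r e))"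
        if "e \<in> out_arcs G i" for e
      proof (rule Suc.IH[OF E(5)[OF that]])
        have "ln (r e) \<le> ln \<rho>" using E(2,3)[OF that] \<rho>pos by simp
        then show "T + ln (r e) < real n * - ln \<rho>" using Suc.prems(2) by (simp add: algebra_simps)
      qed
      \<comment> \<open>Subinvariance of \<open>v\<close> distributes the weight of \<open>i\<close>
        over the heads of its outgoing edges.\<close>
      have "c * v i * exp (s * T) * \<Phi> T \<le> c * Av i * exp (s * T) * \<Phi> T"
        using v(2)[OF Suc.prems(1)] c(1) \<Phi>(1)
        by (intro mult_right_mono mult_left_mono) (auto simp: Av_def)
      also have "\<dots> = (\<Sum>e\<in>out_arcs G i. c * ?h e * (r e powr s * exp (s * T)) * \<Phi> T)"
        by (simp add: Av_def sum_distrib_left sum_distrib_right mult_ac)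
      also have "\<dots> \<le> (\<Sum>e\<in>out_arcs G i. c * ?h e * (r e powr s * exp (s * T)) *
          (\<Phi> (T + ln (r e)) + B * exp (- s * T) * \<phi> T))"
      proof (intro sum_mono mult_left_mono)
        fix e assume e: "e \<in> out_arcs G i"
        show "\<Phi> T \<le> \<Phi> (T + ln (r e)) + B * exp (- s * T) * \<phi> T"
          using step[OF E(1)[OF e]] False by simp
        show "0 \<le> c * ?h e * (r e powr s * exp (s * T))"
          using c(1) E(4)[OF e] by (intro mult_nonneg_nonneg) auto
      qed
      also have "\<dots> = (\<Sum>e\<in>out_arcs G i.
          c * ?h e * exp (s * (T + ln (r e))) * \<Phi> (T + ln (r e)) + c * B * \<phi> T * (r e powr s * ?h e))"
      proof (rule sum.cong[OF refl])
        fix e assume e: "e \<in> out_arcs G i"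
        have "exp (s * T) * exp (- s * T) = 1" by (simp add: exp_add[symmetric])
        then have "c * ?h e * (r e powr s * exp (s * T)) * (B * exp (- s * T) * \<phi> T)
            = c * B * \<phi> T * (r e powr s * ?h e)"
          by (metis (no_types, opaque_lifting) mult.commute mult.left_commute mult.right_neutral)
        then show "c * ?h e * (r e powr s * exp (s * T)) * (\<Phi> (T + ln (r e)) + B * exp (- s * T) * \<phi> T)
          = c * ?h e * exp (s * (T + ln (r e))) * \<Phi> (T + ln (r e)) + c * B * \<phi> T * (r e powr s * ?h e)"
          using powr_exp[OF e] by (simp add: distrib_left)
      qed
      also have "\<dots> = (\<Sum>e\<in>out_arcs G i. c * ?h e * exp (s * (T + ln (r e))) * \<Phi> (T + ln (r e)))
          + c * B * \<phi> T * Av i"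
        by (simp add: sum.distrib Av_def sum_distrib_left)
      also have "\<dots> \<le> (\<Sum>e\<in>out_arcs G i. H (head G e) (T + ln (r e))) + \<phi> T"
      proof (rule add_mono[OF sum_mono[OF IH]])
        have "c * B * \<phi> T * Av i \<le> c * B * \<phi> T * V"
          using V(2)[OF Suc.prems(1)] c(1) \<open>0 < B\<close> \<phi> by (intro mult_left_mono) auto
        also have "\<dots> = \<phi> T * (c * B * V)" by (simp add: mult_ac)
        also have "\<dots> = \<phi> T" using c(2) by simp
        finally show "c * B * \<phi> T * Av i \<le> \<phi> T" .
      qed simp
      also have "\<dots> = H i T"
        using sum_paths_upto_decomp[OF Suc.prems(1), of T \<phi>] False by (simp add: H_def)
      finally show ?thesis .
    qed
  qed
  show ?thesis
  proof
    show "0 < c * v i" using c(1) v(1)[OF i] by simp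
    fix T
    have "0 < - ln \<rho>" using \<rho>pos \<rho>(3) by simp
    then obtain n where "T < real n * - ln \<rho>" using reals_Archimedean3 by blast
    then show "c * v i * exp (s * T) * \<Phi> T \<le> (\<Sum>p\<in>paths_upto i T. \<phi> (T + ln (path_ratio p)))"
      using key[OF i] unfolding H_def by blast
  qed
qed

end

section \<open>The covering integral\<close>

text \<open>Real-valued for use in the renewal inequality. Since \<open>enn2real\<close> sends
  infinity to 0, the value is meaningful only through finiteness, shown in
  \<open>truncated_integral_finite\<close>. For \<open>T < 0\<close> the interval is empty and the
  value is 0.\<close>

definition truncated_integral :: "(real \<Rightarrow> real) \<Rightarrow> real \<Rightarrow> real" where
  "truncated_integral f T = enn2real (\<integral>\<^sup>+t\<in>{0..T}. ennreal (f t) \<partial>lborel)"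

context
  fixes \<phi> :: "real \<Rightarrow> real" and s :: real
  assumes mono: "mono \<phi>" and nonneg: "\<And>t. 0 \<le> \<phi> t" and s: "0 \<le> s"
begin

text \<open>Over a window of length \<open>a\<close> the exponential varies by a factor of at most
  \<open>exp (s * a)\<close>, and the monotone \<open>\<phi>\<close> is largest at the right
  end.\<close>

lemma weighted_le: "0 \<le> a \<Longrightarrow> T - a \<le> t \<Longrightarrow> t \<le> T \<Longrightarrow> exp (- s * t) * \<phi> t \<le> exp (s * a) * exp (- s * T) * \<phi> T"
proof (rule mult_mono)
  assume "T - a \<le> t" "t \<le> T"
  then have "s * (T - a) \<le> s * t" using s by (intro mult_left_mono) auto
  then show "exp (- s * t) \<le> exp (s * a) * exp (- s * T)"
    by (simp add: exp_add[symmetric] algebra_simps)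
qed (use mono nonneg in \<open>auto dest: monoD\<close>)

lemma weighted_measurable: "(\<lambda>t. ennreal (exp (- s * t) * \<phi> t)) \<in> borel_measurable borel"
  using borel_measurable_mono[OF mono] by measurable

text \<open>Split off the last window of length \<open>a\<close> and bound the integrand there by
  its value from \<open>weighted_le\<close>. The shared endpoint does no harm to an upper bound, and
  for \<open>T < a\<close> the first interval is simply empty.\<close>

lemma truncated_integral_step_ennreal:
  assumes "0 \<le> a"
  shows "(\<integral>\<^sup>+t\<in>{0..T}. ennreal (exp (- s * t) * \<phi> t) \<partial>lborel)
    \<le> (\<integral>\<^sup>+t\<in>{0..T - a}. ennreal (exp (- s * t) * \<phi> t) \<partial>lborel)
      + ennreal (a * exp (s * a) * exp (- s * T) * \<phi> T)"
proof -
  let ?f = "\<lambda>t. ennreal (exp (- s * t) * \<phi> t)"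
  let ?k = "ennreal (exp (s * a) * exp (- s * T) * \<phi> T)"
  have "(\<integral>\<^sup>+t\<in>{0..T}. ?f t \<partial>lborel)
      \<le> (\<integral>\<^sup>+t. ?f t * indicator {0..T - a} t + ?k * indicator {T - a..T} t \<partial>lborel)"
  proof (rule nn_integral_mono)
    fix t
    show "?f t * indicator {0..T} t \<le> ?f t * indicator {0..T - a} t + ?k * indicator {T - a..T} t"
      using weighted_le[OF assms, of T t]
      by (cases "t \<le> T - a") (auto simp: indicator_def intro: ennreal_leI add_increasing2)
  qed
  also have "\<dots> = (\<integral>\<^sup>+t\<in>{0..T - a}. ?f t \<partial>lborel) + (\<integral>\<^sup>+t\<in>{T - a..T}. ?k \<partial>lborel)"
    using weighted_measurable
    by (intro nn_integral_add borel_measurable_times_ennreal borel_measurable_indicator) auto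
  also have "(\<integral>\<^sup>+t\<in>{T - a..T}. ?k \<partial>lborel) = ?k * ennreal a"
    using assms by (subst nn_integral_cmult_indicator) auto
  also have "?k * ennreal a = ennreal (a * exp (s * a) * exp (- s * T) * \<phi> T)"
    using assms nonneg[of T] by (simp add: ennreal_mult[symmetric] mult_ac)
  finally show ?thesis .
qed

lemma truncated_integral_finite: "(\<integral>\<^sup>+t\<in>{0..T}. ennreal (exp (- s * t) * \<phi> t) \<partial>lborel) < \<infinity>"
proof (cases "0 \<le> T")
  case True
  \<comment> \<open>With window length \<open>a = T\<close>, only the null set \<open>{0}\<close>
    remains.\<close>
  have "(\<integral>\<^sup>+t\<in>{0..T - T}. ennreal (exp (- s * t) * \<phi> t) \<partial>lborel)
      = (\<integral>\<^sup>+t\<in>{0::real}. ennreal (\<phi> 0) \<partial>lborel)"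
    by (intro nn_integral_cong) (auto simp: indicator_def)
  also have "\<dots> = 0" by (subst nn_integral_cmult_indicator) auto
  finally show ?thesis
    using truncated_integral_step_ennreal[OF True, of T] by (auto simp: le_less_trans)
qed simp

lemma truncated_integral_step:
  assumes "0 \<le> a"
  shows "truncated_integral (\<lambda>t. exp (- s * t) * \<phi> t) T
    \<le> truncated_integral (\<lambda>t. exp (- s * t) * \<phi> t) (T - a) + a * exp (s * a) * exp (- s * T) * \<phi> T"
proof -
  let ?I = "\<lambda>T. \<integral>\<^sup>+t\<in>{0..T}. ennreal (exp (- s * t) * \<phi> t) \<partial>lborel"
  have nn: "0 \<le> a * exp (s * a) * exp (- s * T) * \<phi> T" using assms nonneg by simp
  have "enn2real (?I T) \<le> enn2real (?I (T - a) + ennreal (a * exp (s * a) * exp (- s * T) * \<phi> T))"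
    using truncated_integral_step_ennreal[OF assms, of T] truncated_integral_finite[of "T - a"]
    by (intro enn2real_mono) (auto simp: ennreal_add_eq_top less_top)
  also have "\<dots> = enn2real (?I (T - a)) + a * exp (s * a) * exp (- s * T) * \<phi> T"
    using truncated_integral_finite[of "T - a"] nn by (subst enn2real_plus) auto
  finally show ?thesis unfolding truncated_integral_def .
qed

lemma truncated_integral_at_top:
  assumes inf: "(\<integral>\<^sup>+t\<in>{0..}. ennreal (exp (- s * t) * \<phi> t) \<partial>lborel) = \<infinity>"
  shows "filterlim (truncated_integral (\<lambda>t. exp (- s * t) * \<phi> t)) at_top at_top"
  unfolding filterlim_at_top
proof
  let ?f = "\<lambda>t. ennreal (exp (- s * t) * \<phi> t)"
  let ?I = "\<lambda>T. \<integral>\<^sup>+t\<in>{0..T}. ?f t \<partial>lborel"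
  fix Z :: real
  have "(SUP n. ?I (real n)) = (\<integral>\<^sup>+t. (SUP n. ?f t * indicator {0..real n} t) \<partial>lborel)"
    using weighted_measurable
    by (intro nn_integral_monotone_convergence_SUP[symmetric] incseq_SucI)
      (auto simp: le_fun_def indicator_def)
  also have "\<dots> = (\<integral>\<^sup>+t\<in>{0..}. ?f t \<partial>lborel)"
  proof (intro nn_integral_cong antisym SUP_least)
    fix t :: real
    show "?f t * indicator {0..real n} t \<le> ?f t * indicator {0..} t" for n
      by (auto simp: indicator_def)
    obtain n where "t \<le> real n" using real_arch_simple by blast
    then have "?f t * indicator {0..} t \<le> ?f t * indicator {0..real n} t"
      by (auto simp: indicator_def)
    then show "?f t * indicator {0..} t \<le> (SUP n. ?f t * indicator {0..real n} t)"
      by (rule SUP_upper2[OF UNIV_I])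
  qed
  finally have "(SUP n. ?I (real n)) = \<infinity>" using inf by simp
  \<comment> \<open>\<open>ennreal\<close> truncates negative reals, hence \<open>max 0 Z\<close> in
    place of \<open>Z\<close>.\<close>
  then have "ennreal (max 0 Z) < (SUP n. ?I (real n))"
    by (simp only: infinity_ennreal_def ennreal_less_top)
  then obtain n where n: "ennreal (max 0 Z) < ?I (real n)"
    unfolding less_SUP_iff by blast
  have "Z \<le> truncated_integral (\<lambda>t. exp (- s * t) * \<phi> t) T" if "real n \<le> T" for T
  proof -
    have "?I (real n) \<le> ?I T"
      using that by (intro nn_integral_mono) (auto simp: indicator_def)
    then have "ennreal (max 0 Z) \<le> ?I T" using n by simp
    then have "enn2real (ennreal (max 0 Z)) \<le> enn2real (?I T)"
      using truncated_integral_finite by (intro enn2real_mono) auto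
    then show ?thesis by (simp add: truncated_integral_def)
  qed
  then show "\<forall>\<^sub>F T in at_top. Z \<le> truncated_integral (\<lambda>t. exp (- s * t) * \<phi> t) T"
    unfolding eventually_at_top_linorder by blast
qed

end

section \<open>Combining the covering and renewal estimates\<close>

context scosc
begin

theorem covering_number_inhom_attractor_at_top:
  assumes j: "j \<in> verts G" and i: "i \<in> verts G"
    and inf: "(\<integral>\<^sup>+t\<in>{0..}. ennreal (exp (- s0 G r * t) * real (covering_number (exp (- t)) (C j))) \<partial>lborel) = \<infinity>"
  shows "filterlim (\<lambda>t. real (covering_number (exp (- t)) (inhom_attractor G X S C i)) / exp (s0 G r * t))
    at_top at_top"
proof -
  have ne: "verts G \<noteq> {}" using i by blast
  define s where "s = s0 G r"
  have s: "0 \<le> s" unfolding s_def by (rule s0_nonneg[OF sc ne])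
  define \<phi> where "\<phi> t = real (covering_number (exp (- t)) (C j))" for t
  have mono: "mono \<phi>"
    unfolding \<phi>_def
    by (intro monoI of_nat_mono covering_number_antimono condensation_compact[OF j]) auto
  have nonneg: "0 \<le> \<phi> t" for t by (simp add: \<phi>_def)
  define \<Phi> where "\<Phi> = truncated_integral (\<lambda>t. exp (- s * t) * \<phi> t)"
  have \<Phi>_top: "filterlim \<Phi> at_top at_top"
    unfolding \<Phi>_def using truncated_integral_at_top[OF mono nonneg s] inf by (simp add: \<phi>_def s_def)
  obtain v where v: "\<And>i. i \<in> verts G \<Longrightarrow> 0 < v i"
    "\<And>i. i \<in> verts G \<Longrightarrow> v i \<le> (\<Sum>e\<in>out_arcs G i. r e powr s * v (head G e))"
    unfolding s_def by (rule positive_subinvariant[OF sc ne]) blast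
  obtain m \<rho> where \<rho>: "0 < m" "m \<le> \<rho>" "\<rho> < 1" "\<And>e. e \<in> arcs G \<Longrightarrow> m \<le> r e \<and> r e \<le> \<rho>"
    using ratio_bounds by blast
  \<comment> \<open>The constant of \<open>truncated_integral_step\<close> for the largest possible
    shift \<open>- ln m\<close>, hence valid for all edges.\<close>
  define B where "B = - ln m * exp (s * - ln m)"
  have "0 < B" unfolding B_def using \<rho>(1-3) by (intro mult_pos_pos) auto
  have step: "\<Phi> T \<le> \<Phi> (T + ln (r e)) + B * exp (- s * T) * \<phi> T" if "e \<in> arcs G" for e T
  proof -
    let ?a = "- ln (r e)"
    have r: "m \<le> r e" "0 < r e" "r e < 1" using that \<rho>(4) ratio_pos ratio_less_one by auto
    then have a: "0 \<le> ?a" "?a \<le> - ln m" using \<rho>(1) by auto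
    then have "?a * exp (s * ?a) \<le> B"
      unfolding B_def using s by (intro mult_mono iffD2[OF exp_le_cancel_iff] mult_left_mono) auto
    then have "?a * exp (s * ?a) * exp (- s * T) * \<phi> T \<le> B * exp (- s * T) * \<phi> T"
      using nonneg by (intro mult_right_mono) auto
    then show ?thesis
      using truncated_integral_step[OF mono nonneg s a(1), of T] by (simp add: \<Phi>_def)
  qed
  have \<Phi>_neg: "\<Phi> T = 0" if "T < 0" for T
    using that by (simp add: \<Phi>_def truncated_integral_def)
  have \<Phi>_nonneg: "0 \<le> \<Phi> T" for T
    by (simp add: \<Phi>_def truncated_integral_def)
  obtain c where c: "0 < c"
    "\<And>T. c * exp (s * T) * \<Phi> T \<le> (\<Sum>p\<in>paths_upto i T. \<phi> (T + ln (path_ratio p)))"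
    by (rule renewal_lower_bound[OF v nonneg \<Phi>_nonneg \<Phi>_neg \<open>0 < B\<close> step i]) blast+
  obtain w \<eta> where \<eta>: "0 < \<eta>" and w: "\<And>i. i \<in> verts G \<Longrightarrow> awalk i (w i) j"
    and deep: "\<And>i x. i \<in> verts G \<Longrightarrow> x \<in> X j \<Longrightarrow> ball (path_map (w i) x) \<eta> \<subseteq> U i"
    by (rule uniform_deep_paths[OF j]) blast
  define L where "L = Max ((\<lambda>i. length (w i)) ` verts G)"
  have L: "length (w i) \<le> L" if "i \<in> verts G" for i
    unfolding L_def using that by (intro Max_ge) auto
  define \<kappa> where "\<kappa> = Min ((\<lambda>i. path_ratio (w i)) ` verts G)"
  have "\<kappa> \<in> (\<lambda>i. path_ratio (w i)) ` verts G" unfolding \<kappa>_def using ne by (intro Min_in) auto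
  then obtain k where k: "\<kappa> = path_ratio (w k)" "k \<in> verts G" by (rule imageE)
  then have \<kappa>: "0 < \<kappa>" using path_ratio_pos[OF w[OF k(2)]] by simp
  have \<kappa>_le: "\<kappa> \<le> path_ratio (w i)" if "i \<in> verts G" for i
    unfolding \<kappa>_def using that by (intro Min_le) auto
  \<comment> \<open>The shift from \<open>t\<close> to \<open>T = t - b\<close> absorbs the doubled
    radius, the smallest ratio \<open>\<kappa>\<close> of an attached path, and the threshold
    \<open>2 / \<eta>\<close> for separation.\<close>
  define b where "b = ln (2 / \<kappa> + 2 / \<eta> + 1)"
  have pos: "0 < 2 / \<kappa>" "0 < 2 / \<eta>" using \<kappa> \<eta> by auto
  then have "exp b = 2 / \<kappa> + 2 / \<eta> + 1" unfolding b_def by (intro exp_ln) linarith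
  then have b: "2 / \<kappa> \<le> exp b" "2 / \<eta> < exp b" using pos by linarith+
  let ?N = "\<lambda>t. real (covering_number (exp (- t)) (inhom_attractor G X S C i))"
  have bound: "c * exp (- s * b) / Suc L * \<Phi> (t - b) \<le> ?N t / exp (s * t)" for t
  proof -
    let ?T = "t - b" and ?\<delta> = "exp (- t)"
    let ?D = "deep_piece j w i"
    have path: "\<exists>k. awalk i p k \<and> 2 * ?\<delta> < path_ratio p * \<eta>" if p: "p \<in> paths_upto i ?T" for p
    proof -
      obtain k where k: "awalk i p k" "exp (- ?T) \<le> path_ratio p" using p by (auto simp: paths_upto_def)
      \<comment> \<open>The cutoff for paths is \<open>exp b * ?\<delta>\<close>, so all paths kept
        are long-range enough in ratio for their pieces to be separated at scale
        \<open>?\<delta>\<close>.\<close>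
      have "2 * ?\<delta> < exp b * \<eta> * ?\<delta>" using b(2) \<eta> by (simp add: divide_less_eq)
      also have "\<dots> = exp (- ?T) * \<eta>" by (simp add: exp_diff exp_minus field_simps)
      also have "\<dots> \<le> path_ratio p * \<eta>" using k(2) \<eta> by (intro mult_right_mono) auto
      finally show ?thesis using k(1) by blast
    qed
    have piece: "\<phi> (?T + ln (path_ratio p)) \<le> real (covering_number ?\<delta> (?D p))"
      if p: "p \<in> paths_upto i ?T" for p
    proof -
      obtain k where k: "awalk i p k" using path[OF p] by blast
      then have kV: "k \<in> verts G" by auto
      have pos: "0 < path_ratio p" "0 < path_ratio (w k)"
        using path_ratio_pos[OF k] path_ratio_pos[OF w[OF kV]] by auto
      have "2 / path_ratio (w k) \<le> exp b"
        using b(1) frac_le[of 2 2 \<kappa> "path_ratio (w k)"] \<kappa> \<kappa>_le[OF kV] by simp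
      then have "2 / path_ratio (w k) * (?\<delta> / path_ratio p) \<le> exp b * (?\<delta> / path_ratio p)"
        using pos by (intro mult_right_mono) auto
      moreover have "exp (- (?T + ln (path_ratio p))) = exp b * (?\<delta> / path_ratio p)"
      proof -
        have "- (?T + ln (path_ratio p)) = b + (- t - ln (path_ratio p))" by simp
        then show ?thesis using pos by (simp only: exp_add exp_diff exp_ln)
      qed
      ultimately have "2 * ?\<delta> / (path_ratio p * path_ratio (w k)) \<le> exp (- (?T + ln (path_ratio p)))"
        by (simp add: mult.commute)
      then have "covering_number (exp (- (?T + ln (path_ratio p)))) (C j)
          \<le> covering_number (2 * ?\<delta> / (path_ratio p * path_ratio (w k))) (C j)"
        using pos by (intro covering_number_antimono condensation_compact[OF j]) auto
      also have "\<dots> \<le> covering_number ?\<delta> (?D p)"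
        using covering_number_deep_piece[OF j \<eta> w deep L k, of ?\<delta>] by simp
      finally show ?thesis by (simp add: \<phi>_def)
    qed
    have sum: "(\<Sum>p\<in>paths_upto i ?T. covering_number ?\<delta> (?D p))
        \<le> Suc L * covering_number ?\<delta> (inhom_attractor G X S C i)"
      by (rule sum_covering_number_deep_pieces[OF j \<eta> w deep L finite_paths_upto i _ path]) simp_all
    have "c * exp (s * ?T) * \<Phi> ?T \<le> (\<Sum>p\<in>paths_upto i ?T. \<phi> (?T + ln (path_ratio p)))" by (rule c(2))
    also have "\<dots> \<le> (\<Sum>p\<in>paths_upto i ?T. real (covering_number ?\<delta> (?D p)))"
      by (intro sum_mono piece)
    also have "\<dots> \<le> real (Suc L) * ?N t"
      unfolding of_nat_sum[symmetric] of_nat_mult[symmetric] of_nat_le_iff by (rule sum)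
    finally have main: "c * exp (s * ?T) * \<Phi> ?T \<le> real (Suc L) * ?N t" .
    \<comment> \<open>The shift by \<open>b\<close> costs only the constant factor
      \<open>exp (- s * b)\<close>.\<close>
    have "exp (s * ?T) = exp (- s * b) * exp (s * t)" by (simp add: exp_add[symmetric] algebra_simps)
    then have "c * exp (- s * b) * \<Phi> ?T * exp (s * t) \<le> real (Suc L) * ?N t"
      using main by (simp add: mult_ac)
    then have "c * exp (- s * b) * \<Phi> ?T \<le> real (Suc L) * (?N t / exp (s * t))"
      by (simp only: le_divide_eq times_divide_eq_right) simp
    then show ?thesis
      by (simp only: times_divide_eq_left divide_le_eq) (simp add: mult.commute)
  qed
  have "filterlim (\<lambda>t. t - b) at_top at_top" by real_asymp
  then have "filterlim (\<lambda>t. \<Phi> (t - b)) at_top at_top" by (rule filterlim_compose[OF \<Phi>_top])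
  then have "filterlim (\<lambda>t. c * exp (- s * b) / Suc L * \<Phi> (t - b)) at_top at_top"
    using c(1) by (intro filterlim_tendsto_pos_mult_at_top[OF tendsto_const]) auto
  then show ?thesis
    unfolding s_def[symmetric]
    by (rule filterlim_at_top_mono) (intro always_eventually allI bound)
qed

end

theorem theorem1p2:
  fixes G :: "('v, 'e) pre_digraph"
    and X :: "'v \<Rightarrow> 'a::euclidean_space set"
    and S :: "'e \<Rightarrow> 'a \<Rightarrow> 'a"
    and r :: "'e \<Rightarrow> real"
    and C :: "'v \<Rightarrow> 'a set"
  assumes "inhom_mauldin_williams_graph G X S r C"
    and "mw_strongly_connected G"
    and "strong_condensation_osc G X S C"
    and "\<exists>i\<^sub>0\<in>verts G.
      (\<integral>\<^sup>+t\<in>{0..}. ennreal (exp (- s0 G r * t) * real (covering_number (exp (- t)) (C i\<^sub>0))) \<partial>lborel) = \<infinity>"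
  shows "\<forall>i\<in>verts G.
    filterlim (\<lambda>t. real (covering_number (exp (- t)) (inhom_attractor G X S C i)) / exp (s0 G r * t))
      at_top at_top"
proof -
  interpret inhom_mauldin_williams_graph G X S r C by fact
  obtain U where "\<forall>i\<in>verts G. U i \<noteq> {} \<and> bounded (U i) \<and> open (U i) \<and> U i \<subseteq> X i \<and>
     (\<Union>e\<in>out_arcs G i. S e ` U (head G e)) \<subseteq> U i \<and>
     (\<forall>e\<in>out_arcs G i. \<forall>e'\<in>out_arcs G i. e \<noteq> e' \<longrightarrow>
        S e ` U (head G e) \<inter> S e' ` U (head G e') = {}) \<and>
     U i \<inter> attractor G X S i \<noteq> {} \<and>
     C i \<subseteq> closure (U i) - (\<Union>e\<in>out_arcs G i. S e ` U (head G e))"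
    using assms(3) unfolding strong_condensation_osc_def by (rule exE)
  note U = bspec[OF this]
  have osc: "open (U i)" "U i \<subseteq> X i" "U i \<inter> attractor G X S i \<noteq> {}"
    "(\<Union>e\<in>out_arcs G i. S e ` U (head G e)) \<subseteq> U i"
    "C i \<subseteq> closure (U i) - (\<Union>e\<in>out_arcs G i. S e ` U (head G e))"
    "\<forall>e\<in>out_arcs G i. \<forall>e'\<in>out_arcs G i. e \<noteq> e' \<longrightarrow> S e ` U (head G e) \<inter> S e' ` U (head G e') = {}"
    if "i \<in> verts G" for i
    using U[OF that] by - (elim conjE, assumption)+
  have out: "e \<in> out_arcs G (tail G e)" "tail G e \<in> verts G" if "e \<in> arcs G" for e
    using that by auto
  interpret scosc G X S r C U
  proof unfold_locales
    show "mw_strongly_connected G" by fact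
    fix i assume i: "i \<in> verts G"
    show "open (U i)" "U i \<subseteq> X i" "U i \<inter> attractor G X S i \<noteq> {}" "C i \<subseteq> closure (U i)"
      using osc(1,2,3,5)[OF i] by blast+
  next
    fix e assume e: "e \<in> arcs G"
    show "S e ` U (head G e) \<subseteq> U (tail G e)" "C (tail G e) \<inter> S e ` U (head G e) = {}"
      using osc(4,5)[OF out(2)[OF e]] out(1)[OF e] by blast+
    fix e' assume e': "e' \<in> arcs G" "tail G e = tail G e'" "e \<noteq> e'"
    show "S e ` U (head G e) \<inter> S e' ` U (head G e') = {}"
      using osc(6)[OF out(2)[OF e]] out(1)[OF e] out(1)[OF e'(1)] e'(2,3) by simp
  qed
  show ?thesis
    using assms(4) covering_number_inhom_attractor_at_top by blast
qed

end
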